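(* Let $\mathbf h_N(t)$, $N=1,2,\dots$, be a sequence of Metropolis rate height processes, and let $\mathbf w_N(t)=(w_1(t),\dots,w_N(t))$ be the corresponding third order finite difference processes. Suppose that $$\frac1N\sum_{i=1}^N N^{-3}h_i(0)\to M\quad\text{in probability as }N\to\infty$$ for some deterministic $M$, and that there exists $w_0:\mathbb T\to\mathbb R$ such that $\frac1N\sum_{i=1}^N\phi(i/N)w_i(0)\to\int_{\mathbb T}\phi(x)w_0(x)dx$ in probability as $N\to\infty$ for all $\phi\in C(\mathbb T)$. If $\mathbf w_N$ converges hydrodynamically to a function $w:(0,T]\times\mathbb T\to\mathbb R$ under amplitude scaling $N^0$, and if $$\sup_N\sup_{i=1,\dots,N}\mathbb E|w_i(t)|<\infty\qquad\forall t\ge0,$$ then $\mathbf h_N$ converges hydrodynamically under amplitude scaling $N^3$. The limit $h$ is the unique periodic (in $x$) function such that $\int_0^1h(t,x)dx=M$, $h_{xxx}=w$, and such that $h_x$, $h_{xx}$ are also periodic.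
   Context: $\mathbb T$ denotes the unit interval with periodic boundary conditions. Fix a constant $K>0$ (inverse temperature). Metropolis rate height process: $\mathbf h_N(t)=(h_1(t),\dots,h_N(t))\in\mathbb Z^N$ is a continuous-time Markov jump process on height profiles over the periodic lattice $\{1,\dots,N\}$ (indices mod $N$), started from a random $\mathbf h_N(0)$. For $|i-j|=1$, the jump $\mathbf h\mapsto\mathbf h^{i,j}$ decreases $h_i$ by $1$, increases $h_j$ by $1$ and leaves the other heights unchanged. With $$w_i=z_{i-1}-2z_i+z_{i+1},\quad z_i=h_{i+1}-h_i,\qquad\text{i.e. } w_i=h_{i+2}-3h_{i+1}+3h_i-h_{i-1},$$ the jump $\mathbf h\mapsto\mathbf h^{i,i+1}$ occurs at rate $N^4e^{-3K+Kw_i}$ and the jump $\mathbf h\mapsto\mathbf h^{i+1,i}$ occurs at rate $N^4e^{-3K-Kw_i}$. The third order finite difference process is $\mathbf w_N(t)=(w_1(t),\dots,w_N(t))$ (all entries depend on $N$, suppressed in the notation). Hydrodynamic convergence: let $\mathbf v_N(t)=(v_1(t),\dots,v_N(t))$ be $\mathbf h_N(t)$ or $\mathbf w_N(t)$, initialized so that for some $v_0:\mathbb T\to\mathbb R$, $\frac1N\sum_{i=1}^N\phi(i/N)N^{-\beta}v_i(0)\to\int_{\mathbb T}\phi(x)v_0(x)dx$ in probability as $N\to\infty$ for all $\phi\in C(\mathbb T)$. Then $\mathbf v_N$ converges hydrodynamically to $v:(0,T]\times\mathbb T\to\mathbb R$ under amplitude scaling $N^\beta$ if for each $t\in(0,T]$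 and $\phi\in C(\mathbb T)$, $$\frac1N\sum_{i=1}^N\phi\left(\frac iN\right)N^{-\beta}v_i(t)\to\int_{\mathbb T}\phi(x)v(t,x)dx\quad\text{in probability as }N\to\infty$$ (the time scaling $N^4$ is already built into the jump rates). *)

theory Defs
  imports "HOL-Probability.Probability"
begin

section \<open>Continuous-time Markov jump processes\<close>

text \<open>Off-diagonal rates \<open>q x y\<close> (\<open>x \<noteq> y\<close>) on a countable state space; the diagonal values are ignored.\<close>

definition exit_rate :: "('s \<Rightarrow> 's \<Rightarrow> real) \<Rightarrow> 's \<Rightarrow> real" where
  "exit_rate q x = (\<Sum>\<^sub>\<infinity>y\<in>- {x}. q x y)"

definition jump_prob :: "('s \<Rightarrow> 's \<Rightarrow> real) \<Rightarrow> 's \<Rightarrow> 's \<Rightarrow> real" where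
  "jump_prob q x y =
     (if exit_rate q x = 0 then of_bool (y = x)
      else if y = x then 0 else q x y / exit_rate q x)"

text \<open>The jump chain/holding time definition: \<open>Y\<close> is the embedded jump chain and \<open>R n\<close> is the time
  spent in state \<open>Y n\<close>. Given the jump chain, the holding times are independent and exponential
  with parameters \<open>exit_rate q (Y n)\<close>. They are extended nonnegative reals because the holding time in
  an absorbing state (\<open>exit_rate q x = 0\<close>) is infinite; the equation below forces this, as
  \<open>exp (- 0 * s) = 1\<close> for all real \<open>s\<close>. The initial law is arbitrary, and there is almost surely no
  explosion.\<close>

definition markov_jump_process ::
  "'s set \<Rightarrow> ('s \<Rightarrow> 's \<Rightarrow> real) \<Rightarrow> 'a measure \<Rightarrow> (real \<Rightarrow> 'a \<Rightarrow> 's) \<Rightarrow> bool" where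
  "markov_jump_process S q P X \<longleftrightarrow>
     prob_space P \<and>
     (\<forall>t\<ge>0. X t \<in> measurable P (count_space S)) \<and>
     (\<exists>(Y :: nat \<Rightarrow> 'a \<Rightarrow> 's) (R :: nat \<Rightarrow> 'a \<Rightarrow> ennreal).
        (\<forall>n. Y n \<in> measurable P (count_space S)) \<and>
        (\<forall>n. R n \<in> borel_measurable P) \<and>
        (\<forall>n y s. (\<forall>k\<le>n. y k \<in> S) \<and> (\<forall>k<n. 0 \<le> s k) \<longrightarrow>
           measure P {\<omega> \<in> space P. (\<forall>k\<le>n. Y k \<omega> = y k) \<and> (\<forall>k<n. ennreal (s k) < R k \<omega>)}
           = measure P {\<omega> \<in> space P. Y 0 \<omega> = y 0}
             * (\<Prod>k<n. exp (- exit_rate q (y k) * s k) * jump_prob q (y k) (y (Suc k)))) \<and>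
        (AE \<omega> in P.
           (\<Sum>n. R n \<omega>) = \<infinity> \<and>
           (\<forall>n. \<forall>t\<ge>0. (\<Sum>k<n. R k \<omega>) \<le> ennreal t \<and> ennreal t < (\<Sum>k<Suc n. R k \<omega>)
              \<longrightarrow> X t \<omega> = Y n \<omega>)))"


section \<open>The Metropolis rate height process\<close>

text \<open>A vector indexed by the periodic lattice \<open>{1,\<dots>,N}\<close> is an \<open>N\<close>-periodic function on the integers.\<close>

definition profiles :: "nat \<Rightarrow> (int \<Rightarrow> int) set" where
  "profiles N = {h. \<forall>i. h (i + int N) = h i}"

definition slope :: "(int \<Rightarrow> int) \<Rightarrow> int \<Rightarrow> int" where
  "slope h i = h (i + 1) - h i"

definition third_diff :: "(int \<Rightarrow> int) \<Rightarrow> int \<Rightarrow> int" where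
  "third_diff h i = slope h (i - 1) - 2 * slope h i + slope h (i + 1)"

lemma third_diff_eq: "third_diff h i = h (i + 2) - 3 * h (i + 1) + 3 * h i - h (i - 1)"
  by (simp add: third_diff_def slope_def add.assoc)

definition jump :: "nat \<Rightarrow> int \<Rightarrow> int \<Rightarrow> (int \<Rightarrow> int) \<Rightarrow> (int \<Rightarrow> int)" where
  "jump N i j h =
     (\<lambda>k. h k - of_bool (k mod int N = i mod int N) + of_bool (k mod int N = j mod int N))"

definition height_rate :: "real \<Rightarrow> nat \<Rightarrow> (int \<Rightarrow> int) \<Rightarrow> (int \<Rightarrow> int) \<Rightarrow> real" where
  "height_rate K N h h' =
     (\<Sum>i\<in>{1..int N}.
        real N ^ 4 * exp (- 3 * K + K * of_int (third_diff h i)) * of_bool (h' = jump N i (i + 1) h)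
      + real N ^ 4 * exp (- 3 * K - K * of_int (third_diff h i)) * of_bool (h' = jump N (i + 1) i h))"

definition metropolis_height_process ::
  "real \<Rightarrow> nat \<Rightarrow> 'a measure \<Rightarrow> (real \<Rightarrow> 'a \<Rightarrow> int \<Rightarrow> int) \<Rightarrow> bool" where
  "metropolis_height_process K N P h \<longleftrightarrow> markov_jump_process (profiles N) (height_rate K N) P h"


section \<open>Hydrodynamic convergence\<close>

text \<open>Functions on the torus are 1-periodic functions on the reals; integrals over the torus are
  Lebesgue integrals over the unit interval.\<close>

definition torus_fun :: "(real \<Rightarrow> real) \<Rightarrow> bool" where
  "torus_fun f \<longleftrightarrow> (\<forall>x. f (x + 1) = f x)"

text \<open>The \<open>N\<close>-th random variable may live on its own probability space.\<close>

definition tendsto_in_prob ::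
  "(nat \<Rightarrow> 'a measure) \<Rightarrow> (nat \<Rightarrow> 'a \<Rightarrow> real) \<Rightarrow> real \<Rightarrow> bool" where
  "tendsto_in_prob P X c \<longleftrightarrow>
     (\<forall>\<epsilon>>0. (\<lambda>N. measure (P N) {\<omega> \<in> space (P N). \<bar>X N \<omega> - c\<bar> > \<epsilon>}) \<longlonglongrightarrow> 0)"

text \<open>Integrability of the limit profile is what makes its integrals against
  continuous functions meaningful.\<close>

definition profile_tendsto ::
  "(nat \<Rightarrow> 'a measure) \<Rightarrow> real \<Rightarrow> (nat \<Rightarrow> 'a \<Rightarrow> int \<Rightarrow> int) \<Rightarrow> (real \<Rightarrow> real) \<Rightarrow> bool" where
  "profile_tendsto P \<beta> v u \<longleftrightarrow>
     torus_fun u \<and> u absolutely_integrable_on {0..1} \<and>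
     (\<forall>\<phi>. torus_fun \<phi> \<and> continuous_on UNIV \<phi> \<longrightarrow>
        tendsto_in_prob P
          (\<lambda>N \<omega>. 1 / real N *
             (\<Sum>i\<in>{1..int N}. \<phi> (of_int i / real N) * real N powr (- \<beta>) * of_int (v N \<omega> i)))
          (integral {0..1} (\<lambda>x. \<phi> x * u x)))"

definition converges_hydrodynamically ::
  "(nat \<Rightarrow> 'a measure) \<Rightarrow> real \<Rightarrow> real \<Rightarrow> (nat \<Rightarrow> real \<Rightarrow> 'a \<Rightarrow> int \<Rightarrow> int)
    \<Rightarrow> (real \<Rightarrow> real \<Rightarrow> real) \<Rightarrow> bool" where
  "converges_hydrodynamically P \<beta> T v u \<longleftrightarrow>
     (\<exists>u0. profile_tendsto P \<beta> (\<lambda>N. v N 0) u0) \<and>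
     (\<forall>t\<in>{0<..T}. profile_tendsto P \<beta> (\<lambda>N. v N t) (u t))"


section \<open>The limit profile\<close>

definition absolutely_continuous_fun_on :: "real set \<Rightarrow> (real \<Rightarrow> real) \<Rightarrow> bool" where
  "absolutely_continuous_fun_on S f \<longleftrightarrow>
     (\<forall>\<epsilon>>0. \<exists>\<delta>>0. \<forall>D.
        finite D \<and> (\<forall>(a, b)\<in>D. a \<le> b \<and> {a..b} \<subseteq> S) \<and>
        pairwise (\<lambda>(a, b) (c, d). {a<..<b} \<inter> {c<..<d} = {}) D \<and>
        (\<Sum>(a, b)\<in>D. b - a) < \<delta>
        \<longrightarrow> (\<Sum>(a, b)\<in>D. \<bar>f b - f a\<bar>) < \<epsilon>)"

text \<open>The periodic functions \<open>g\<close> with mean \<open>m\<close>, \<open>g\<^sub>x\<^sub>x\<^sub>x = w\<close> and \<open>g\<^sub>x\<close>, \<open>g\<^sub>x\<^sub>x\<close> periodic. Since \<open>w\<close> is merely an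
  integrable function, determined only up to null sets by its integrals against continuous functions,
  the third derivative is taken in the sense that \<open>g\<^sub>x\<^sub>x\<close> is absolutely continuous with derivative
  \<open>w\<close> almost everywhere; \<open>g\<close> and \<open>g\<^sub>x\<close> are differentiable everywhere.\<close>

definition periodic_third_primitive ::
  "real \<Rightarrow> (real \<Rightarrow> real) \<Rightarrow> (real \<Rightarrow> real) \<Rightarrow> bool" where
  "periodic_third_primitive m w g \<longleftrightarrow>
     torus_fun g \<and> integral {0..1} g = m \<and>
     (\<exists>gx gxx.
        (\<forall>x. (g has_real_derivative gx x) (at x)) \<and> torus_fun gx \<and>
        (\<forall>x. (gx has_real_derivative gxx x) (at x)) \<and> torus_fun gxx \<and>
        absolutely_continuous_fun_on {0..1} gxx \<and>
        (AE x in lebesgue. (gxx has_real_derivative w x) (at x)))"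

end

theory Submission
  imports Defs
begin

text \<open>
  Fix a time and a continuous test function \<open>\<phi>\<close> on the circle, and let \<open>c\<close> be its mean. The mean-zero part
  of \<open>\<phi>\<close> is minus the third derivative of a periodic function \<open>\<psi>\<close>. Summation by parts on the lattice
  turns a sum of the heights \<open>h\<^sub>i\<close> against \<open>\<phi> - c\<close> into a sum of the third differences \<open>w\<^sub>i\<close> against \<open>\<psi>\<close>;
  each of the three discrete derivatives gains a factor \<open>1 / N\<close>, which is why heights of order \<open>N ^ 3\<close>
  correspond to third differences of order one. Hence the tested height profile is
  \<open>c\<close> times the scaled mean height plus the tested third difference profile, up to an error
  (\<open>test_function_estimate\<close>). The last summand converges by hypothesis. The mean height is preserved by every
  jump, hence almost surely constant in time (\<open>height_sum_conserved\<close>), so it converges to \<open>m\<close>.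
  The limit \<open>c * m\<close> plus the integral of \<open>\<psi> w\<close> is, after three integrations by parts, the integral of \<open>\<phi>\<close>
  against the periodic third primitive of \<open>w\<close> with mean \<open>m\<close> (\<open>integral_periodic_third_primitive\<close>).

  The error comes from replacing a discrete third derivative of \<open>\<psi>\<close> by the exact one. It is the modulus of
  continuity of \<open>\<phi>\<close> at scale \<open>2 / N\<close> times the average of \<open>\<bar>h\<^sub>i\<bar> / N ^ 3\<close>, so an a priori bound on the heights is
  needed. This is where the bound on the expectations of \<open>\<bar>w\<^sub>i\<bar>\<close> enters: a discrete Poincare inequality,
  used three times, bounds every scaled height by the scaled mean height plus the average of the \<open>\<bar>w\<^sub>i\<bar>\<close>
  (\<open>height_bound\<close>), and the latter is bounded in probability (\<open>tendsto_in_prob_dominated\<close>).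

  That the periodic third primitive exists requires \<open>w\<close> to have mean zero, which the limit inherits from the
  third differences (\<open>third_diff_limit_mean_zero\<close>). Since \<open>w\<close> is merely integrable, existence rests on
  Lebesgue's differentiation theorem and absolute continuity of the indefinite integral, while uniqueness and the
  integration by parts rest on the fundamental theorem of calculus for absolutely continuous
  functions (\<open>has_integral_absolutely_continuous\<close>).
\<close>


section \<open>Absolutely continuous functions\<close>

definition short_intervals :: "real set \<Rightarrow> real \<Rightarrow> (real \<times> real) set \<Rightarrow> bool" where
  "short_intervals S \<delta> D \<longleftrightarrow>
     finite D \<and> (\<forall>(a, b)\<in>D. a \<le> b \<and> {a..b} \<subseteq> S) \<and>
     pairwise (\<lambda>(a, b) (c, d). {a<..<b} \<inter> {c<..<d} = {}) D \<and>
     (\<Sum>(a, b)\<in>D. b - a) < \<delta>"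

lemma absolutely_continuous_iff:
  "absolutely_continuous_fun_on S f \<longleftrightarrow>
     (\<forall>\<epsilon>>0. \<exists>\<delta>>0. \<forall>D. short_intervals S \<delta> D \<longrightarrow> (\<Sum>(a, b)\<in>D. \<bar>f b - f a\<bar>) < \<epsilon>)"
  unfolding absolutely_continuous_fun_on_def short_intervals_def ..

text \<open>A tagged division delivers intervals indexed by tag--interval pairs, while the definition of
  absolute continuity speaks of a set of endpoint pairs. Passing from one to the other is safe
  because two distinct indices can share their endpoints only if the interval is a single point,
  and such intervals contribute nothing to either sum.\<close>

lemma absolutely_continuous_family:
  assumes "absolutely_continuous_fun_on S f" "\<epsilon> > 0"
  obtains \<delta> where "\<delta> > 0"
    "\<And>(I :: 'i set) a b. \<lbrakk>finite I; \<And>i. i \<in> I \<Longrightarrow> a i \<le> b i \<and> {a i..b i} \<subseteq> S;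
       \<And>i j. \<lbrakk>i \<in> I; j \<in> I; i \<noteq> j\<rbrakk> \<Longrightarrow> {a i<..<b i} \<inter> {a j<..<b j} = {};
       (\<Sum>i\<in>I. b i - a i) < \<delta>\<rbrakk> \<Longrightarrow> (\<Sum>i\<in>I. \<bar>f (b i) - f (a i)\<bar>) < \<epsilon>"
proof -
  obtain \<delta> where \<delta>: "\<delta> > 0" "\<And>D. short_intervals S \<delta> D
        \<Longrightarrow> (\<Sum>(a, b)\<in>D. \<bar>f b - f a\<bar>) < \<epsilon>"
    using assms unfolding absolutely_continuous_iff by metis
  show thesis
  proof (rule that[OF \<delta>(1)])
    fix I :: "'i set" and a b
    assume I: "finite I" "\<And>i. i \<in> I \<Longrightarrow> a i \<le> b i \<and> {a i..b i} \<subseteq> S"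
      and dis: "\<And>i j. \<lbrakk>i \<in> I; j \<in> I; i \<noteq> j\<rbrakk> \<Longrightarrow> {a i<..<b i} \<inter> {a j<..<b j} = {}"
      and len: "(\<Sum>i\<in>I. b i - a i) < \<delta>"
    define J where "J = {i\<in>I. a i < b i}"
    have J: "finite J" "J \<subseteq> I" using I(1) by (auto simp: J_def)
    have inj: "inj_on (\<lambda>i. (a i, b i)) J"
    proof (rule inj_onI)
      fix i j assume ij: "i \<in> J" "j \<in> J" "(a i, b i) = (a j, b j)"
      then have "(a i + b i) / 2 \<in> {a i<..<b i} \<inter> {a j<..<b j}" by (auto simp: J_def)
      with dis[of i j] ij J(2) show "i = j" by blast
    qed
    have deg: "b i = a i" if "i \<in> I - J" for i
      using I(2)[of i] that unfolding J_def by auto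
    have "(\<Sum>i\<in>I. b i - a i) = (\<Sum>i\<in>J. b i - a i)"
      using I(1) J(2) deg by (intro sum.mono_neutral_right) auto
    also have "\<dots> = (\<Sum>(a, b)\<in>(\<lambda>i. (a i, b i)) ` J. b - a)"
      by (simp add: sum.reindex[OF inj])
    finally have len': "(\<Sum>(a, b)\<in>(\<lambda>i. (a i, b i)) ` J. b - a) < \<delta>" using len by simp
    have "(\<Sum>i\<in>I. \<bar>f (b i) - f (a i)\<bar>) = (\<Sum>i\<in>J. \<bar>f (b i) - f (a i)\<bar>)"
      using I(1) J(2) deg by (intro sum.mono_neutral_right) auto
    also have "\<dots> = (\<Sum>(a, b)\<in>(\<lambda>i. (a i, b i)) ` J. \<bar>f b - f a\<bar>)"
      by (simp add: sum.reindex[OF inj])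
    also have "\<dots> < \<epsilon>"
    proof (rule \<delta>(2), unfold short_intervals_def, intro conjI len')
      show "finite ((\<lambda>i. (a i, b i)) ` J)" using J(1) by simp
      show "\<forall>(a, b)\<in>(\<lambda>i. (a i, b i)) ` J. a \<le> b \<and> {a..b} \<subseteq> S" using I(2) J(2) by blast
      show "pairwise (\<lambda>(a, b) (c, d). {a<..<b} \<inter> {c<..<d} = {}) ((\<lambda>i. (a i, b i)) ` J)"
        unfolding pairwise_def using dis J(2) by fastforce
    qed
    finally show "(\<Sum>i\<in>I. \<bar>f (b i) - f (a i)\<bar>) < \<epsilon>" .
  qed
qed

lemma disjoint_intervals_length_le:
  fixes a b :: "'i \<Rightarrow> real"
  assumes "finite I" "\<And>i. i \<in> I \<Longrightarrow> a i \<le> b i \<and> {a i<..<b i} \<subseteq> U"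
    and dis: "\<And>i j. \<lbrakk>i \<in> I; j \<in> I; i \<noteq> j\<rbrakk> \<Longrightarrow> {a i<..<b i} \<inter> {a j<..<b j} = {}"
    and "U \<in> lmeasurable"
  shows "(\<Sum>i\<in>I. b i - a i) \<le> measure lebesgue U"
proof -
  have "(\<Sum>i\<in>I. b i - a i) = (\<Sum>i\<in>I. measure lebesgue {a i<..<b i})"
    using assms(2) by (intro sum.cong) auto
  also have "\<dots> = measure lebesgue (\<Union>i\<in>I. {a i<..<b i})"
  proof (rule measure_finite_Union[symmetric])
    show "disjoint_family_on (\<lambda>i. {a i<..<b i}) I"
      using dis by (auto simp: disjoint_family_on_def)
  qed (use assms in auto)
  also have "\<dots> \<le> measure lebesgue U"
    using assms by (intro measure_mono_fmeasurable) auto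
  finally show ?thesis .
qed

text \<open>The fundamental theorem of calculus for absolutely continuous functions, proved directly from the
  gauge definition of the integral. At tags outside \<open>Z\<close> the gauge enforces that increments are
  almost linear with slope \<open>f'\<close>; at tags in \<open>Z\<close> it confines the intervals to an open set of small
  measure, where absolute continuity makes the total increment small. With \<open>f' = 0\<close> it says that
  there is no singular part, which gives uniqueness of the limit profile; applied to a product it
  gives the integration by parts.\<close>

lemma has_integral_absolutely_continuous:
  fixes f f' :: "real \<Rightarrow> real"
  assumes "a \<le> b" and ac: "absolutely_continuous_fun_on {a..b} f"
    and "negligible Z"
    and der: "\<And>x. x \<in> {a..b} - Z \<Longrightarrow> (f has_real_derivative f' x) (at x)"
  shows "(f' has_integral (f b - f a)) {a..b}"
proof -
  \<comment> \<open>Changing \<open>f'\<close> to \<open>0\<close> on \<open>Z\<close> removes the tags in \<open>Z\<close> from the Riemann sums.\<close>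
  define g where "g = (\<lambda>x. if x \<in> Z then 0 else f' x)"
  have "(g has_integral (f b - f a)) {a..b}"
    unfolding has_integral_real
  proof (intro allI impI)
    fix e :: real assume e: "e > 0"
    define e1 where "e1 = e / (2 * (b - a + 1))"
    have e1: "e1 > 0" "e1 * (b - a) < e / 2"
      using e \<open>a \<le> b\<close> by (auto simp: e1_def field_simps)
    obtain \<delta> where \<delta>: "\<delta> > 0"
      "\<And>(I :: (real \<times> real set) set) a' b'. \<lbrakk>finite I; \<And>i. i \<in> I \<Longrightarrow> a' i \<le> b' i \<and> {a' i..b' i} \<subseteq> {a..b};
       \<And>i j. \<lbrakk>i \<in> I; j \<in> I; i \<noteq> j\<rbrakk> \<Longrightarrow> {a' i<..<b' i} \<inter> {a' j<..<b' j} = {};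
       (\<Sum>i\<in>I. b' i - a' i) < \<delta>\<rbrakk> \<Longrightarrow> (\<Sum>i\<in>I. \<bar>f (b' i) - f (a' i)\<bar>) < e / 2"
    proof (rule absolutely_continuous_family[OF ac, of "e / 2", where 'i = "real \<times> real set"])
      show "e / 2 > 0" using e by simp
    qed blast
    obtain U where U: "open U" "Z \<subseteq> U" "U \<in> lmeasurable" "measure lebesgue U < \<delta>"
    proof -
      have Z: "Z \<in> lmeasurable" "measure lebesgue Z = 0"
        using \<open>negligible Z\<close> negligible_iff_measure by auto
      obtain U where U: "open U" "Z \<subseteq> U" "U - Z \<in> lmeasurable" "emeasure lebesgue (U - Z) < ennreal \<delta>"
        using sets_lebesgue_outer_open[of Z \<delta>] Z(1) \<delta>(1) by blast
      have UZ: "U = Z \<union> (U - Z)" using U(2) by auto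
      then have "U \<in> lmeasurable" using Z(1) U(3) by (metis fmeasurable.Un)
      moreover have "measure lebesgue U \<le> measure lebesgue Z + measure lebesgue (U - Z)"
        using UZ Z(1) U(3) measure_Un_le[of Z lebesgue "U - Z"] by auto
      moreover have "measure lebesgue (U - Z) < \<delta>"
        using U(3,4) \<delta>(1) by (simp add: emeasure_eq_measure2 ennreal_less_iff)
      ultimately show thesis using that U Z(2) by auto
    qed
    have "\<exists>d>0. \<forall>y. \<bar>y - x\<bar> < d \<longrightarrow> \<bar>f y - f x - f' x * (y - x)\<bar> \<le> e1 * \<bar>y - x\<bar>"
      if "x \<in> {a..b} - Z" for x
      using der[OF that] e1(1)
      unfolding has_field_derivative_def has_derivative_at_alt
      by (auto simp: mult.commute)
    then obtain d where d: "\<And>x. x \<in> {a..b} - Z \<Longrightarrow> d x > 0"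
      "\<And>x y. \<lbrakk>x \<in> {a..b} - Z; \<bar>y - x\<bar> < d x\<rbrakk> \<Longrightarrow> \<bar>f y - f x - f' x * (y - x)\<bar> \<le> e1 * \<bar>y - x\<bar>"
      by metis
    \<comment> \<open>Points of \<open>Z\<close> are covered by the small open set, all others get their differentiability radius.\<close>
    define \<gamma> where "\<gamma> = (\<lambda>x. if x \<in> Z then U else if x \<in> {a..b} then ball x (d x) else UNIV)"
    have gauge: "gauge \<gamma>"
      using U(1,2) d(1) by (auto simp: gauge_def \<gamma>_def)
    show "\<exists>\<gamma>. gauge \<gamma> \<and> (\<forall>\<D>. \<D> tagged_division_of {a..b} \<and> \<gamma> fine \<D> \<longrightarrow>
            norm ((\<Sum>(x, k)\<in>\<D>. measure lborel k *\<^sub>R g x) - (f b - f a)) < e)"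
    proof (intro exI[of _ \<gamma>] conjI gauge allI impI, elim conjE)
      fix p assume p: "p tagged_division_of {a..b}" and fine: "\<gamma> fine p"
      note fin = tagged_division_ofD(1)[OF p]
      have K: "Inf K \<le> x" "x \<le> Sup K" "K = {Inf K..Sup K}" "K \<subseteq> {a..b}" "x \<in> {a..b}" "K \<subseteq> \<gamma> x"
        if xK: "(x, K) \<in> p" for x K
      proof -
        obtain u v where "K = {u..v}" using tagged_division_ofD(4)[OF p xK] by auto
        moreover have "x \<in> K" "K \<subseteq> {a..b}" using tagged_division_ofD(2,3)[OF p xK] by auto
        ultimately show "Inf K \<le> x" "x \<le> Sup K" "K = {Inf K..Sup K}" "K \<subseteq> {a..b}" "x \<in> {a..b}"
          by auto
        show "K \<subseteq> \<gamma> x" using fine xK by (auto simp: fine_def)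
      qed
      have content: "measure lborel K = Sup K - Inf K" if "(x, K) \<in> p" for x K
        using K(1,2,3)[OF that] by (metis content_real order_trans)
      have dis: "{Inf K<..<Sup K} \<inter> {Inf L<..<Sup L} = {}"
        if "(x, K) \<in> p" "(y, L) \<in> p" "(x, K) \<noteq> (y, L)" for x y K L
        using tagged_division_ofD(5)[OF p that] K(3)[OF that(1)] K(3)[OF that(2)]
        by (metis interior_atLeastAtMost_real)
      define p1 p2 where "p1 = {xK\<in>p. fst xK \<in> Z}" and "p2 = {xK\<in>p. fst xK \<notin> Z}"
      have p12: "p = p1 \<union> p2" "p1 \<inter> p2 = {}" "finite p1" "finite p2" "p1 \<subseteq> p" "p2 \<subseteq> p"
        using fin by (auto simp: p1_def p2_def)
      have dis1: "{Inf (snd i)<..<Sup (snd i)} \<inter> {Inf (snd j)<..<Sup (snd j)} = {}"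
        if "i \<in> p1" "j \<in> p1" "i \<noteq> j" for i j
        using dis[of "fst i" "snd i" "fst j" "snd j"] that p12(5) by auto
      define \<Delta> where "\<Delta> = (\<lambda>(x, K). measure lborel K * g x - (f (Sup K) - f (Inf K)))"
      have "(\<Sum>(x, k)\<in>p. measure lborel k *\<^sub>R g x) - (f b - f a) = sum \<Delta> p"
        unfolding \<Delta>_def additive_tagged_division_1[OF \<open>a \<le> b\<close> p, of f, symmetric]
        by (simp add: sum_subtractf[symmetric] case_prod_unfold)
      also have "\<dots> = sum \<Delta> p1 + sum \<Delta> p2"
        using p12 by (metis sum.union_disjoint)
      finally have eq: "(\<Sum>(x, k)\<in>p. measure lborel k *\<^sub>R g x) - (f b - f a) = sum \<Delta> p1 + sum \<Delta> p2" .
      have "\<bar>sum \<Delta> p1\<bar> \<le> (\<Sum>xK\<in>p1. \<bar>f (Sup (snd xK)) - f (Inf (snd xK))\<bar>)"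
        by (intro order_trans[OF sum_abs] sum_mono) (auto simp: \<Delta>_def p1_def g_def)
      also have "\<dots> < e / 2"
      proof (rule \<delta>(2))
        have "(\<Sum>xK\<in>p1. Sup (snd xK) - Inf (snd xK)) \<le> measure lebesgue U"
        proof (rule disjoint_intervals_length_le)
          fix i assume "i \<in> p1"
          then obtain x L where i: "i = (x, L)" "(x, L) \<in> p" "x \<in> Z" by (cases i) (auto simp: p1_def)
          have "L \<subseteq> U" using K(6)[OF i(2)] i(3) by (auto simp: \<gamma>_def)
          then show "Inf (snd i) \<le> Sup (snd i) \<and> {Inf (snd i)<..<Sup (snd i)} \<subseteq> U"
            using K[OF i(2)] unfolding i(1)
            by (metis (no_types, opaque_lifting) greaterThanLessThan_subseteq_atLeastAtMost_iff order_refl order_trans snd_conv)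
        qed (use p12(3) U(3) in \<open>auto simp del: Int_greaterThanLessThan dest: dis1\<close>)
        then show "(\<Sum>xK\<in>p1. Sup (snd xK) - Inf (snd xK)) < \<delta>" using U(4) by simp
        fix i assume "i \<in> p1"
        then obtain x L where i: "i = (x, L)" "(x, L) \<in> p" by (cases i) (auto simp: p1_def)
        show "Inf (snd i) \<le> Sup (snd i) \<and> {Inf (snd i)..Sup (snd i)} \<subseteq> {a..b}"
          using K[OF i(2)] unfolding i(1) by (metis order_trans snd_conv)
      qed (use p12(3) in \<open>auto simp del: Int_greaterThanLessThan dest: dis1\<close>)
      finally have b1: "\<bar>sum \<Delta> p1\<bar> < e / 2" .
      have "\<bar>sum \<Delta> p2\<bar> \<le> (\<Sum>(x,K)\<in>p2. e1 * measure lborel K)"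
      proof (intro order_trans[OF sum_abs] sum_mono, clarify)
        fix x L assume "(x, L) \<in> p2"
        then have xL: "(x, L) \<in> p" "x \<notin> Z" by (auto simp: p2_def)
        note k = K[OF xL(1)]
        have "x \<in> {a..b} - Z" using k(5) xL(2) by simp
        have "L \<subseteq> ball x (d x)" using k(5,6) xL(2) by (auto simp: \<gamma>_def)
        moreover have "Inf L \<in> L" "Sup L \<in> L"
          using k(1-3) by (metis atLeastAtMost_iff order_refl order_trans)+
        ultimately have near: "\<bar>Inf L - x\<bar> < d x" "\<bar>Sup L - x\<bar> < d x"
          by (auto simp: dist_real_def subset_iff abs_minus_commute)
        have "\<bar>f (Inf L) - f x - f' x * (Inf L - x)\<bar> \<le> e1 * (x - Inf L)"
             "\<bar>f (Sup L) - f x - f' x * (Sup L - x)\<bar> \<le> e1 * (Sup L - x)"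
          using d(2)[OF \<open>x \<in> {a..b} - Z\<close> near(1)] d(2)[OF \<open>x \<in> {a..b} - Z\<close> near(2)] k(1,2) by auto
        then have "\<bar>(Sup L - Inf L) * f' x - (f (Sup L) - f (Inf L))\<bar> \<le> e1 * (Sup L - Inf L)"
          by (simp add: algebra_simps abs_le_iff)
        then show "\<bar>\<Delta> (x, L)\<bar> \<le> e1 * measure lborel L"
          using xL by (simp add: \<Delta>_def g_def content)
      qed
      also have "\<dots> \<le> (\<Sum>(x,K)\<in>p. e1 * measure lborel K)"
        using p12 fin e1 by (intro sum_mono2) auto
      also have "\<dots> = e1 * (b - a)"
      proof -
        have "(\<Sum>(x,K)\<in>p. measure lborel K) = b - a"
          using additive_content_tagged_division[of p a b] p \<open>a \<le> b\<close> by simp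
        then show ?thesis by (simp add: sum_distrib_left[symmetric] case_prod_unfold)
      qed
      also have "\<dots> < e / 2" by (rule e1)
      finally have b2: "\<bar>sum \<Delta> p2\<bar> < e / 2" .
      show "norm ((\<Sum>(x, k)\<in>p. measure lborel k *\<^sub>R g x) - (f b - f a)) < e"
        unfolding eq real_norm_def using b1 b2 by linarith
    qed
  qed
  then show ?thesis
    by (rule has_integral_spike[OF \<open>negligible Z\<close>, rotated]) (auto simp: g_def)
qed

text \<open>With \<open>f\<close> absolutely continuous, this makes products of \<open>f\<close> with Lipschitz functions absolutely
  continuous, and covers the addition of Lipschitz terms as well.\<close>

lemma absolutely_continuous_dominated:
  assumes "absolutely_continuous_fun_on S f" "A \<ge> 0" "B \<ge> 0"
    and dom: "\<And>x y. \<lbrakk>x \<le> y; {x..y} \<subseteq> S\<rbrakk> \<Longrightarrow> \<bar>g y - g x\<bar> \<le> A * \<bar>f y - f x\<bar> + B * (y - x)"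
  shows "absolutely_continuous_fun_on S g"
  unfolding absolutely_continuous_iff
proof (intro allI impI)
  fix \<epsilon> :: real assume "\<epsilon> > 0"
  define \<epsilon>' where "\<epsilon>' = \<epsilon> / (2 * (A + 1))"
  have e': "\<epsilon>' > 0" "A * \<epsilon>' < \<epsilon> / 2" using \<open>\<epsilon> > 0\<close> assms(2) by (auto simp: \<epsilon>'_def field_simps)
  obtain \<delta> where \<delta>: "\<delta> > 0" "\<And>D. short_intervals S \<delta> D
        \<Longrightarrow> (\<Sum>(a, b)\<in>D. \<bar>f b - f a\<bar>) < \<epsilon>'"
    using assms(1) e'(1) unfolding absolutely_continuous_iff by metis
  define \<delta>' where "\<delta>' = min \<delta> (\<epsilon> / (2 * (B + 1)))"
  have \<delta>': "\<delta>' > 0" "\<delta>' \<le> \<delta>" "B * \<delta>' \<le> \<epsilon> / 2"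
  proof -
    show "\<delta>' > 0" "\<delta>' \<le> \<delta>" using \<delta>(1) \<open>\<epsilon> > 0\<close> assms(3) by (auto simp: \<delta>'_def)
    have "B * \<delta>' \<le> B * (\<epsilon> / (2 * (B + 1)))" using assms(3) by (intro mult_left_mono) (auto simp: \<delta>'_def)
    also have "\<dots> \<le> \<epsilon> / 2" using \<open>\<epsilon> > 0\<close> assms(3) by (auto simp: field_simps)
    finally show "B * \<delta>' \<le> \<epsilon> / 2" .
  qed
  show "\<exists>\<delta>>0. \<forall>D. short_intervals S \<delta> D
        \<longrightarrow> (\<Sum>(a, b)\<in>D. \<bar>g b - g a\<bar>) < \<epsilon>"
  proof (intro exI[of _ \<delta>'] conjI \<delta>'(1) allI impI)
    fix D assume D: "short_intervals S \<delta>' D"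
    have "(\<Sum>(a, b)\<in>D. \<bar>g b - g a\<bar>) \<le> (\<Sum>(a, b)\<in>D. A * \<bar>f b - f a\<bar> + B * (b - a))"
      using D dom by (intro sum_mono) (auto simp: short_intervals_def)
    also have "\<dots> = A * (\<Sum>(a, b)\<in>D. \<bar>f b - f a\<bar>) + B * (\<Sum>(a, b)\<in>D. b - a)"
      by (simp add: sum.distrib sum_distrib_left case_prod_unfold)
    also have "\<dots> \<le> A * \<epsilon>' + B * \<delta>'"
    proof (intro add_mono mult_left_mono assms)
      show "(\<Sum>(a, b)\<in>D. \<bar>f b - f a\<bar>) \<le> \<epsilon>'" using \<delta>(2)[of D] D \<delta>'(2) by (force simp: short_intervals_def)
      show "(\<Sum>(a, b)\<in>D. b - a) \<le> \<delta>'" using D by (simp add: short_intervals_def)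
    qed
    also have "\<dots> < \<epsilon>" using e'(2) \<delta>'(3) by linarith
    finally show "(\<Sum>(a, b)\<in>D. \<bar>g b - g a\<bar>) < \<epsilon>" .
  qed
qed

lemma absolutely_continuous_diff:
  assumes "absolutely_continuous_fun_on S f" "absolutely_continuous_fun_on S g"
  shows "absolutely_continuous_fun_on S (\<lambda>x. f x - g x)"
  unfolding absolutely_continuous_iff
proof (intro allI impI)
  fix \<epsilon> :: real assume "\<epsilon> > 0"
  then have e: "\<epsilon> / 2 > 0" by simp
  obtain \<delta>1 where 1: "\<delta>1 > 0" "\<And>D. short_intervals S \<delta>1 D \<Longrightarrow> (\<Sum>(a, b)\<in>D. \<bar>f b - f a\<bar>) < \<epsilon> / 2"
    using assms(1) e unfolding absolutely_continuous_iff by metis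
  obtain \<delta>2 where 2: "\<delta>2 > 0" "\<And>D. short_intervals S \<delta>2 D \<Longrightarrow> (\<Sum>(a, b)\<in>D. \<bar>g b - g a\<bar>) < \<epsilon> / 2"
    using assms(2) e unfolding absolutely_continuous_iff by metis
  show "\<exists>\<delta>>0. \<forall>D. short_intervals S \<delta> D \<longrightarrow> (\<Sum>(a, b)\<in>D. \<bar>f b - g b - (f a - g a)\<bar>) < \<epsilon>"
  proof (intro exI[of _ "min \<delta>1 \<delta>2"] conjI allI impI)
    fix D assume D: "short_intervals S (min \<delta>1 \<delta>2) D"
    have "(\<Sum>(a, b)\<in>D. \<bar>f b - g b - (f a - g a)\<bar>) \<le> (\<Sum>(a, b)\<in>D. \<bar>f b - f a\<bar> + \<bar>g b - g a\<bar>)"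
      by (intro sum_mono) auto
    also have "\<dots> = (\<Sum>(a, b)\<in>D. \<bar>f b - f a\<bar>) + (\<Sum>(a, b)\<in>D. \<bar>g b - g a\<bar>)"
      by (simp add: sum.distrib case_prod_unfold)
    also have "\<dots> < \<epsilon>" using 1(2)[of D] 2(2)[of D] D by (force simp: short_intervals_def)
    finally show "(\<Sum>(a, b)\<in>D. \<bar>f b - g b - (f a - g a)\<bar>) < \<epsilon>" .
  qed (use 1 2 in auto)
qed

lemma absolutely_continuous_subset:
  assumes "absolutely_continuous_fun_on S f" "T \<subseteq> S"
  shows "absolutely_continuous_fun_on T f"
proof -
  have "short_intervals S \<delta> D" if "short_intervals T \<delta> D" for \<delta> D
    using that assms(2) unfolding short_intervals_def by (blast intro: order_trans)
  then show ?thesis using assms(1) unfolding absolutely_continuous_iff by meson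
qed

lemma absolutely_continuous_imp_continuous:
  assumes "absolutely_continuous_fun_on {a..b} f"
  shows "continuous_on {a..b} f"
  unfolding continuous_on_iff
proof (intro ballI allI impI)
  fix x e :: real assume x: "x \<in> {a..b}" and "e > 0"
  then obtain d where d: "d > 0" "\<And>D. short_intervals {a..b} d D \<Longrightarrow> (\<Sum>(a, b)\<in>D. \<bar>f b - f a\<bar>) < e"
    using assms unfolding absolutely_continuous_iff by blast
  show "\<exists>d>0. \<forall>y\<in>{a..b}. dist y x < d \<longrightarrow> dist (f y) (f x) < e"
  proof (intro exI[of _ d] conjI d(1) ballI impI)
    fix y assume "y \<in> {a..b}" "dist y x < d"
    then have "short_intervals {a..b} d {(min x y, max x y)}"
      using x by (auto simp: short_intervals_def dist_real_def)
    from d(2)[OF this] show "dist (f y) (f x) < e"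
      by (auto simp: dist_real_def min_def max_def split: if_splits)
  qed
qed

lemma closed_Int_subset_endpoints:
  fixes a b c d :: real
  assumes "{a<..<b} \<inter> {c<..<d} = {}"
  shows "{a..b} \<inter> {c..d} \<subseteq> {a, b, c, d}"
proof
  fix x assume x: "x \<in> {a..b} \<inter> {c..d}"
  show "x \<in> {a, b, c, d}"
  proof (rule ccontr)
    assume "x \<notin> {a, b, c, d}"
    with x have "x \<in> {a<..<b} \<inter> {c<..<d}" by auto
    with assms show False by blast
  qed
qed

text \<open>Truncation: \<open>\<bar>w\<bar> \<le> k + r\<close> with \<open>r = max (\<bar>w\<bar> - k) 0\<close>, and the integral of \<open>r\<close> over all of
  \<open>{c..d}\<close> is small for large \<open>k\<close> by dominated convergence. The constant part contributes at most
  \<open>k\<close> times the total length of the intervals.\<close>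

lemma absolutely_continuous_indefinite_integral:
  fixes w F :: "real \<Rightarrow> real"
  assumes w: "w absolutely_integrable_on {c..d}"
    and F: "\<And>a b. \<lbrakk>c \<le> a; a \<le> b; b \<le> d\<rbrakk> \<Longrightarrow> F b - F a = integral {a..b} w"
  shows "absolutely_continuous_fun_on {c..d} F"
  unfolding absolutely_continuous_iff
proof (intro allI impI)
  fix \<epsilon> :: real assume "\<epsilon> > 0"
  define r where "r = (\<lambda>(k::nat) x. max (\<bar>w x\<bar> - real k) 0)"
  have absw: "(\<lambda>x. \<bar>w x\<bar>) absolutely_integrable_on {c..d}"
    using absolutely_integrable_norm[OF w] by (simp add: o_def)
  have r_int: "r k absolutely_integrable_on {c..d}" for k
    unfolding r_def
    by (intro absolutely_integrable_max_1 set_integral_diff absw) auto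
  have "(\<lambda>k. integral {c..d} (r k)) \<longlonglongrightarrow> integral {c..d} (\<lambda>x. 0)"
  proof (rule dominated_convergence(2)[where h = "\<lambda>x. \<bar>w x\<bar>"])
    show "r k integrable_on {c..d}" for k using r_int by (simp add: absolutely_integrable_on_def)
    show "(\<lambda>x. \<bar>w x\<bar>) integrable_on {c..d}" using absw by (simp add: absolutely_integrable_on_def)
    show "norm (r k x) \<le> \<bar>w x\<bar>" if "x \<in> {c..d}" for k x by (auto simp: r_def)
    show "(\<lambda>k. r k x) \<longlonglongrightarrow> 0" if "x \<in> {c..d}" for x
    proof (rule tendsto_eventually)
      show "\<forall>\<^sub>F k in sequentially. r k x = 0"
        using eventually_ge_at_top[of "nat \<lceil>\<bar>w x\<bar>\<rceil>"] by eventually_elim (simp add: r_def)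
    qed
  qed
  then have "(\<lambda>k. integral {c..d} (r k)) \<longlonglongrightarrow> 0" by simp
  then have "\<forall>\<^sub>F k in sequentially. integral {c..d} (r k) < \<epsilon> / 2"
    using \<open>\<epsilon> > 0\<close> by (intro order_tendstoD) auto
  then obtain k where k: "integral {c..d} (r k) < \<epsilon> / 2"
    using eventually_happens by fastforce
  define \<delta> where "\<delta> = \<epsilon> / (2 * (real k + 1))"
  have \<delta>: "\<delta> > 0" "real k * \<delta> < \<epsilon> / 2"
    using \<open>\<epsilon> > 0\<close> by (auto simp: \<delta>_def field_simps)
  show "\<exists>\<delta>>0. \<forall>D. short_intervals {c..d} \<delta> D \<longrightarrow> (\<Sum>(a, b)\<in>D. \<bar>F b - F a\<bar>) < \<epsilon>"
  proof (intro exI[of _ \<delta>] conjI \<delta> allI impI)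
    fix D assume D: "short_intervals {c..d} \<delta> D"
    then have finD: "finite D" and len: "(\<Sum>(a, b)\<in>D. b - a) < \<delta>"
      and pair: "pairwise (\<lambda>(a, b) (c, d). {a<..<b} \<inter> {c<..<d} = {}) D"
      by (simp_all add: short_intervals_def)
    have sub: "a \<le> b \<and> c \<le> a \<and> b \<le> d" if "(a, b) \<in> D" for a b
    proof -
      have "a \<le> b" "{a..b} \<subseteq> {c..d}" using D that by (auto simp: short_intervals_def)
      then show ?thesis by simp
    qed
    have rI: "r k integrable_on {a..b}" and wI: "w integrable_on {a..b}"
      and awI: "(\<lambda>x. \<bar>w x\<bar>) integrable_on {a..b}" if "(a, b) \<in> D" for a b
      using sub[OF that] r_int[of k] w absw
      by (auto simp: absolutely_integrable_on_def intro: integrable_on_subinterval)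
    have "(\<Sum>(a, b)\<in>D. \<bar>F b - F a\<bar>) \<le> (\<Sum>(a, b)\<in>D. real k * (b - a) + integral {a..b} (r k))"
    proof (intro sum_mono, clarify)
      fix a b assume ab: "(a, b) \<in> D"
      have "\<bar>F b - F a\<bar> \<le> integral {a..b} (\<lambda>x. \<bar>w x\<bar>)"
        using F sub[OF ab] integral_norm_bound_integral[OF wI[OF ab] awI[OF ab]] by simp
      also have "\<dots> \<le> integral {a..b} (\<lambda>x. real k + r k x)"
        by (intro integral_le awI[OF ab] integrable_add integrable_const_ivl rI[OF ab]) (auto simp: r_def)
      also have "\<dots> = real k * (b - a) + integral {a..b} (r k)"
        using sub[OF ab] by (subst integral_add) (auto intro: rI[OF ab] integrable_const_ivl)
      finally show "\<bar>F b - F a\<bar> \<le> real k * (b - a) + integral {a..b} (r k)" .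
    qed
    also have "\<dots> = real k * (\<Sum>(a, b)\<in>D. b - a) + (\<Sum>(a, b)\<in>D. integral {a..b} (r k))"
      by (simp add: sum.distrib sum_distrib_left case_prod_unfold)
    also have "(\<Sum>(a, b)\<in>D. integral {a..b} (r k)) \<le> integral {c..d} (r k)"
    proof -
      have *: "(r k has_integral (\<Sum>ab\<in>D. integral {fst ab..snd ab} (r k))) (\<Union>ab\<in>D. {fst ab..snd ab})"
      proof (rule has_integral_UN[OF finD])
        show "(r k has_integral integral {fst ab..snd ab} (r k)) {fst ab..snd ab}" if "ab \<in> D" for ab
          using rI[of "fst ab" "snd ab"] that by (simp add: integrable_integral)
        show "pairwise (\<lambda>i i'. negligible ({fst i..snd i} \<inter> {fst i'..snd i'})) D"
        proof (rule pairwiseI)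
          fix i j assume ij: "i \<in> D" "j \<in> D" "i \<noteq> j"
          have "{fst i<..<snd i} \<inter> {fst j<..<snd j} = {}"
            using pairwiseD[OF pair ij] by (simp add: case_prod_unfold)
          then have "{fst i..snd i} \<inter> {fst j..snd j} \<subseteq> {fst i, snd i, fst j, snd j}"
            by (rule closed_Int_subset_endpoints)
          then show "negligible ({fst i..snd i} \<inter> {fst j..snd j})"
            by (rule negligible_subset[rotated]) simp
        qed
      qed
      have "(\<Sum>ab\<in>D. integral {fst ab..snd ab} (r k)) \<le> integral {c..d} (r k)"
      proof (rule has_integral_subset_le[OF _ * integrable_integral])
        show "(\<Union>ab\<in>D. {fst ab..snd ab}) \<subseteq> {c..d}"
        proof
          fix x assume "x \<in> (\<Union>ab\<in>D. {fst ab..snd ab})"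
          then obtain a b where "(a, b) \<in> D" "a \<le> x" "x \<le> b" by auto
          with sub[of a b] show "x \<in> {c..d}" by simp
        qed
        show "r k integrable_on {c..d}" using r_int[of k] by (simp add: absolutely_integrable_on_def)
        show "\<forall>x\<in>{c..d}. 0 \<le> r k x" by (simp add: r_def)
      qed
      then show ?thesis by (simp add: case_prod_unfold)
    qed
    also have "real k * (\<Sum>(a, b)\<in>D. b - a) + integral {c..d} (r k) < \<epsilon>"
    proof -
      have "real k * (\<Sum>(a, b)\<in>D. b - a) \<le> real k * \<delta>" using len by (intro mult_left_mono) auto
      then show ?thesis using \<delta>(2) k by linarith
    qed
    finally show "(\<Sum>(a, b)\<in>D. \<bar>F b - F a\<bar>) < \<epsilon>" by simp
  qed
qed

text \<open>Lebesgue differentiation in the form of an ordinary derivative.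
  \<open>integrable_ccontinuous_explicit\<close> controls averages over intervals to the right of a point; applying
  it to the reflected function as well controls averages to the left.\<close>

lemma AE_derivative_indefinite_integral:
  fixes w F :: "real \<Rightarrow> real"
  assumes int: "\<And>a b. w integrable_on {a..b}"
    and F: "\<And>a b. a \<le> b \<Longrightarrow> F b - F a = integral {a..b} w"
  obtains Z where "negligible Z" "\<And>x. x \<notin> Z \<Longrightarrow> (F has_real_derivative w x) (at x)"
proof -
  obtain N1 where N1: "negligible N1"
    "\<And>x e. \<lbrakk>x \<notin> N1; 0 < e\<rbrakk> \<Longrightarrow> \<exists>d>0. \<forall>h. 0 < h \<and> h < d \<longrightarrow>
        norm (integral (cbox x (x + h *\<^sub>R One)) w /\<^sub>R h ^ DIM(real) - w x) < e"
    by (rule integrable_ccontinuous_explicit[of w, unfolded interval_cbox, OF int[unfolded interval_cbox]]) blast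
  have int': "(\<lambda>x. w (- x)) integrable_on cbox a b" for a b
    using int[of "- b" "- a"] Henstock_Kurzweil_Integration.integrable_reflect_real[where f = w and a = "-b" and b = "-a"] by simp
  obtain N2 where N2: "negligible N2"
    "\<And>x e. \<lbrakk>x \<notin> N2; 0 < e\<rbrakk> \<Longrightarrow> \<exists>d>0. \<forall>h. 0 < h \<and> h < d \<longrightarrow>
        norm (integral (cbox x (x + h *\<^sub>R One)) (\<lambda>x. w (- x)) /\<^sub>R h ^ DIM(real) - w (- x)) < e"
    by (rule integrable_ccontinuous_explicit[of "\<lambda>x. w (- x)", OF int']) blast
  show thesis
  proof (rule that[of "N1 \<union> uminus ` N2"])
    have "linear (uminus :: real \<Rightarrow> real)" by (rule linear_uminus)
    then show "negligible (N1 \<union> uminus ` N2)"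
      using N1(1) N2(1) by (intro negligible_Un negligible_differentiable_image_negligible linear_imp_differentiable_on) simp_all
    fix x assume x: "x \<notin> N1 \<union> uminus ` N2"
    have x2: "- x \<notin> N2"
    proof
      assume "- x \<in> N2"
      then have "- (- x) \<in> uminus ` N2" by (rule imageI)
      with x show False by simp
    qed
    show "(F has_real_derivative w x) (at x)"
      unfolding DERIV_def
    proof (rule LIM_I)
      fix e :: real assume "e > 0"
      obtain d1 where d1: "d1 > 0" "\<And>h. \<lbrakk>0 < h; h < d1\<rbrakk> \<Longrightarrow> \<bar>integral {x..x + h} w / h - w x\<bar> < e"
      proof -
        obtain d where "d > 0" "\<forall>h. 0 < h \<and> h < d \<longrightarrow>
            norm (integral (cbox x (x + h *\<^sub>R One)) w /\<^sub>R h ^ DIM(real) - w x) < e"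
          using N1(2)[of x e] x \<open>e > 0\<close> by blast
        then show thesis by (intro that[of d]) (simp_all add: divide_inverse mult.commute)
      qed
      obtain d2 where d2: "d2 > 0" "\<And>h. \<lbrakk>0 < h; h < d2\<rbrakk> \<Longrightarrow>
          \<bar>integral {- x..- x + h} (\<lambda>x. w (- x)) / h - w x\<bar> < e"
      proof -
        obtain d where "d > 0" "\<forall>h. 0 < h \<and> h < d \<longrightarrow>
            norm (integral (cbox (- x) (- x + h *\<^sub>R One)) (\<lambda>x. w (- x)) /\<^sub>R h ^ DIM(real) - w (- (- x))) < e"
          using N2(2)[of "- x" e] x2 \<open>e > 0\<close> by blast
        then show thesis by (intro that[of d]) (simp_all add: divide_inverse mult.commute)
      qed
      show "\<exists>s>0. \<forall>h. h \<noteq> 0 \<and> norm (h - 0) < s \<longrightarrow> norm ((F (x + h) - F x) / h - w x) < e"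
      proof (intro exI[of _ "min d1 d2"] conjI allI impI)
        show "min d1 d2 > 0" using d1 d2 by simp
        fix h :: real assume h: "h \<noteq> 0 \<and> norm (h - 0) < min d1 d2"
        show "norm ((F (x + h) - F x) / h - w x) < e"
        proof (cases "h > 0")
          case True
          then show ?thesis using d1(2)[of h] F[of x "x + h"] h by simp
        next
          case False
          have "integral {-x..-x+(-h)} (\<lambda>x. w (- x)) = integral {x + h..x} w"
            using Henstock_Kurzweil_Integration.integral_reflect_real[where f = w and a = "x + h" and b = x] by simp
          then have "(F (x + h) - F x) / h = integral {-x..-x+(-h)} (\<lambda>x. w (- x)) / (- h)"
            using F[of "x + h" x] False h by (simp add: field_simps)
          then show ?thesis using d2(2)[of "- h"] h False by simp
        qed
      qed
    qed
  qed
qed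


section \<open>Primitives of periodic functions\<close>

lemma periodic_nat: "torus_fun f \<Longrightarrow> f (x + real n) = f x"
  by (induction n) (auto simp: torus_fun_def add.assoc[symmetric] add.commute[of 1])

lemma periodic_int:
  assumes f: "torus_fun f"
  shows "f (x + of_int k) = f x"
proof (cases "k \<ge> 0")
  case True
  then show ?thesis using periodic_nat[OF f, of x "nat k"] by simp
next
  case False
  then show ?thesis using periodic_nat[OF f, of "x + of_int k" "nat (- k)"] by simp
qed

lemma periodic_frac: "torus_fun f \<Longrightarrow> f (frac x) = f x"
  using periodic_int[of f "frac x" "\<lfloor>x\<rfloor>"] by (simp add: frac_def)

text \<open>Translating by an integer moves \<open>x\<close> into the unit interval and keeps a nearby \<open>y\<close> in
  \<open>{-1..2}\<close>, where compactness applies.\<close>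

lemma periodic_uniformly_continuous:
  fixes f :: "real \<Rightarrow> real"
  assumes f: "torus_fun f" "continuous_on UNIV f" and "e > 0"
  obtains d where "d > 0" "\<And>x y. \<bar>x - y\<bar> < d \<Longrightarrow> \<bar>f x - f y\<bar> < e"
proof -
  have "uniformly_continuous_on {- 1..2} f"
    using f(2) by (intro compact_uniformly_continuous) (auto intro: continuous_on_subset)
  then obtain d where d: "d > 0" "\<And>x y. \<lbrakk>x \<in> {- 1..2}; y \<in> {- 1..2}; dist y x < d\<rbrakk> \<Longrightarrow> dist (f y) (f x) < e"
    unfolding uniformly_continuous_on_def using \<open>e > 0\<close> by blast
  show thesis
  proof (rule that[of "min d 1"])
    fix x y :: real assume xy: "\<bar>x - y\<bar> < min d 1"
    define k where "k = \<lfloor>x\<rfloor>"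
    have "real_of_int k \<le> x" "x < real_of_int k + 1" unfolding k_def by linarith+
    then have "y - of_int k \<in> {- 1..2}" "x - of_int k \<in> {- 1..2}" using xy by auto
    then have "\<bar>f (x - of_int k) - f (y - of_int k)\<bar> < e"
      using d(2)[of "y - of_int k" "x - of_int k"] xy by (simp add: dist_real_def)
    then show "\<bar>f x - f y\<bar> < e"
      using periodic_int[OF f(1), of _ "- k"] by simp
  qed (use d in auto)
qed

lemma periodic_integrable:
  fixes w :: "real \<Rightarrow> real"
  assumes w: "torus_fun w" "w integrable_on {0..1}"
  shows "w integrable_on {a..b}"
proof -
  have up: "w integrable_on {real n..real n + 1}" for n
    using integrable_shift_real_ivl_iff[of w "real n" "real n" "real n + 1"] w(2)
    by (simp add: periodic_nat[OF w(1)])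
  have down: "w integrable_on {- real n - 1..- real n}" for n
  proof -
    have "- real n - 1 = 0 - real (Suc n)" "- real n = 1 - real (Suc n)" by auto
    then show ?thesis
      using integrable_shift_real_ivl_iff[of w "real (Suc n)" 0 1] w(2)
      by (simp only: periodic_nat[OF w(1)])
  qed
  have "w integrable_on {- real n..real n}" for n
  proof (induction n)
    case (Suc n)
    have "w integrable_on {- real n - 1..real n}"
      by (rule Henstock_Kurzweil_Integration.integrable_combine[OF _ _ down Suc]) auto
    then have "w integrable_on {- real n - 1..real n + 1}"
      by (rule Henstock_Kurzweil_Integration.integrable_combine[rotated 2, OF _ up]) auto
    moreover have "{- real n - 1..real n + 1} = {- real (Suc n)..real (Suc n)}" by auto
    ultimately show ?case by (simp only:)
  qed (simp add: integrable_on_refl[where a = "0::real", simplified])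
  moreover obtain n where "max \<bar>a\<bar> \<bar>b\<bar> \<le> real n" using real_arch_simple by blast
  then have "{a..b} \<subseteq> {- real n..real n}" by auto
  ultimately show ?thesis using integrable_on_subinterval by blast
qed

lemma periodic_integral_shift:
  assumes "torus_fun w" shows "integral {a + 1..b + 1} w = integral {a..b} (w :: real \<Rightarrow> real)"
  using integral_shift_real_ivl[of "a + 1" 1 "b + 1" w] assms by (simp add: torus_fun_def)

text \<open>The integral from \<open>0\<close> to \<open>x\<close> with its sign for negative \<open>x\<close>; vanishing mean over one period is
  exactly what makes it periodic.\<close>

lemma periodic_indefinite_integral:
  fixes w :: "real \<Rightarrow> real"
  assumes w: "torus_fun w" "w integrable_on {0..1}" "integral {0..1} w = 0"
  obtains F where "torus_fun F" "continuous_on UNIV F" "\<And>a b. a \<le> b \<Longrightarrow> F b - F a = integral {a..b} w"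
proof
  define F where "F = (\<lambda>x. integral {0..x} w - integral {x..0} w)"
  note int = periodic_integrable[OF w(1,2)]
  have combine: "integral {a..b} w + integral {b..c} w = integral {a..c} w" if "a \<le> b" "b \<le> c" for a b c
    using that int by (intro Henstock_Kurzweil_Integration.integral_combine) auto
  have empty: "integral {a..b} w = 0" if "b \<le> a" for a b
    using that by (cases "a = b") auto
  show F: "F b - F a = integral {a..b} w" if "a \<le> b" for a b
  proof -
    consider "0 \<le> a" | "a < 0" "0 \<le> b" | "b < 0" by linarith
    then show ?thesis
    proof cases
      case 1
      then show ?thesis using combine[of 0 a b] empty[of 0 a] empty[of 0 b] that by (simp add: F_def)
    next
      case 2
      then show ?thesis using combine[of a 0 b] empty[of a 0] empty[of 0 b] by (simp add: F_def)
    next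
      case 3
      then show ?thesis using combine[of a b 0] empty[of a 0] empty[of b 0] that by (simp add: F_def)
    qed
  qed
  show "torus_fun F"
    unfolding torus_fun_def
  proof
    fix x
    have 1: "F 1 = F 0" using F[of 0 1] w(3) by simp
    show "F (x + 1) = F x"
    proof (cases "0 \<le> x")
      case True
      then show ?thesis using F[of 0 x] F[of 1 "x + 1"] periodic_integral_shift[OF w(1), of 0 x] 1 by simp
    next
      case False
      then show ?thesis using F[of x 0] F[of "x + 1" 1] periodic_integral_shift[OF w(1), of x 0] 1 by simp
    qed
  qed
  show "continuous_on UNIV F"
  proof (clarsimp simp: continuous_on_eq_continuous_at)
    fix x
    have "continuous_on {x - 1..x + 1} (\<lambda>y. F (x - 1) + integral {x - 1..y} w)"
      by (intro continuous_intros indefinite_integral_continuous_1 int)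
    then have "continuous_on {x - 1..x + 1} F"
    proof (rule continuous_on_eq)
      fix y assume "y \<in> {x - 1..x + 1}"
      then show "F (x - 1) + integral {x - 1..y} w = F y" using F[of "x - 1" y] by simp
    qed
    then show "isCont F x"
      by (rule continuous_on_interior) simp
  qed
qed

text \<open>Continuous mean-zero functions on the circle have primitives on the circle, and the constant of
  integration can be used to prescribe the mean. Prescribing mean zero allows the construction to be
  iterated.\<close>

lemma periodic_primitive:
  fixes f :: "real \<Rightarrow> real"
  assumes f: "continuous_on UNIV f" "torus_fun f" "integral {0..1} f = 0"
  obtains F where "\<And>x. (F has_real_derivative f x) (at x)" "torus_fun F" "integral {0..1} F = c"
proof -
  obtain G where G: "\<And>x. (G has_real_derivative f x) (at x)"
    using einterval_antiderivative[of "-\<infinity>" "\<infinity>" f] f(1)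
    by (auto simp: continuous_on_eq_continuous_at has_real_derivative_iff_has_vector_derivative)
  have contG: "continuous_on S G" for S
    using G by (meson DERIV_isCont continuous_at_imp_continuous_on)
  have 1: "G 1 - G 0 = 0"
  proof -
    have "(f has_integral (G 1 - G 0)) {0..1}"
      using G by (intro fundamental_theorem_of_calculus)
        (auto simp: has_real_derivative_iff_has_vector_derivative[symmetric] intro: has_field_derivative_at_within)
    then show ?thesis using f(3) by (simp add: integral_unique)
  qed
  have perG: "G (x + 1) = G x" for x
  proof -
    have "((\<lambda>x. G (x + 1) - G x) has_real_derivative f (x + 1) - f x) (at x)" for x
      by (intro DERIV_diff G) (use G[of "x + 1"] DERIV_shift[of G "f (x + 1)" x 1] in simp)
    then have "((\<lambda>x. G (x + 1) - G x) has_real_derivative 0) (at x)" for x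
      using f(2) by (simp add: torus_fun_def)
    then have "G (x + 1) - G x = G (0 + 1) - G 0" by (intro DERIV_isconst_all) simp
    then show ?thesis using 1 by simp
  qed
  define k where "k = c - integral {0..1} G"
  show thesis
  proof (rule that[of "\<lambda>x. G x + k"])
    show "((\<lambda>x. G x + k) has_real_derivative f x) (at x)" for x
      using DERIV_add[OF G DERIV_const] by simp
    show "torus_fun (\<lambda>x. G x + k)" using perG by (simp add: torus_fun_def)
    have "integral {0..1} (\<lambda>x. G x + k) = integral {0..1} G + integral {0..1} (\<lambda>x::real. k)"
      by (intro integral_add integrable_continuous_real contG continuous_on_const)
    then show "integral {0..1} (\<lambda>x. G x + k) = c" by (simp add: k_def)
  qed
qed

text \<open>The mean has to be split off: only the mean-zero part of a test function is the third derivative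
  of a function on the circle.\<close>

lemma ex_triple_primitive_of_test_function:
  assumes \<phi>: "torus_fun \<phi>" "continuous_on UNIV \<phi>"
  obtains \<psi> \<psi>1 \<psi>2 where
    "\<And>x. (\<psi> has_real_derivative \<psi>1 x) (at x)" "\<And>x. (\<psi>1 has_real_derivative \<psi>2 x) (at x)"
    "\<And>x. (\<psi>2 has_real_derivative (integral {0..1} \<phi> - \<phi> x)) (at x)"
    "torus_fun \<psi>" "torus_fun \<psi>1" "torus_fun \<psi>2"
proof -
  have I: "\<phi> integrable_on {0..1}"
    using \<phi>(2) continuous_on_subset by (intro integrable_continuous_real) blast
  have "integral {0..1} (\<lambda>x. integral {0..1} \<phi> - \<phi> x) = integral {0..1} (\<lambda>x::real. integral {0..1} \<phi>) - integral {0..1} \<phi>"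
    by (intro integral_diff I) (rule integrable_const_ivl)
  then have 0: "integral {0..1} (\<lambda>x. integral {0..1} \<phi> - \<phi> x) = 0" by simp
  obtain \<psi>2 where 2: "\<And>x. (\<psi>2 has_real_derivative (integral {0..1} \<phi> - \<phi> x)) (at x)" "torus_fun \<psi>2" "integral {0..1} \<psi>2 = 0"
  proof (rule periodic_primitive[OF _ _ 0, of 0])
    show "continuous_on UNIV (\<lambda>x. integral {0..1} \<phi> - \<phi> x)" using \<phi>(2) by (intro continuous_intros)
    show "torus_fun (\<lambda>x. integral {0..1} \<phi> - \<phi> x)" using \<phi>(1) by (simp add: torus_fun_def)
  qed blast
  have "continuous_on UNIV \<psi>2" using 2(1) by (meson DERIV_isCont continuous_at_imp_continuous_on)
  then obtain \<psi>1 where 1: "\<And>x. (\<psi>1 has_real_derivative \<psi>2 x) (at x)" "torus_fun \<psi>1" "integral {0..1} \<psi>1 = 0"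
    using periodic_primitive[OF _ 2(2,3), of 0] by blast
  have "continuous_on UNIV \<psi>1" using 1(1) by (meson DERIV_isCont continuous_at_imp_continuous_on)
  then obtain \<psi> where "\<And>x. (\<psi> has_real_derivative \<psi>1 x) (at x)" "torus_fun \<psi>"
    using periodic_primitive[OF _ 1(2,3), of 0] by blast
  with 1 2 show thesis by (intro that)
qed


section \<open>Periodic third primitives\<close>

lemma periodic_third_primitiveE:
  assumes "periodic_third_primitive m w g"
  obtains gx gxx Z where "torus_fun g" "integral {0..1} g = m"
    "\<And>x. (g has_real_derivative gx x) (at x)" "torus_fun gx"
    "\<And>x. (gx has_real_derivative gxx x) (at x)" "torus_fun gxx"
    "absolutely_continuous_fun_on {0..1} gxx"
    "negligible Z" "\<And>x. x \<notin> Z \<Longrightarrow> (gxx has_real_derivative w x) (at x)"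
proof -
  obtain gx gxx where g: "torus_fun g" "integral {0..1} g = m"
    "\<And>x. (g has_real_derivative gx x) (at x)" "torus_fun gx"
    "\<And>x. (gx has_real_derivative gxx x) (at x)" "torus_fun gxx"
    "absolutely_continuous_fun_on {0..1} gxx"
    and ae: "AE x in lebesgue. (gxx has_real_derivative w x) (at x)"
    using assms unfolding periodic_third_primitive_def by blast
  obtain Z where "Z \<in> null_sets lebesgue" "{x \<in> space lebesgue. \<not> (gxx has_real_derivative w x) (at x)} \<subseteq> Z"
    using ae unfolding eventually_ae_filter by blast
  then have "negligible Z" "\<And>x. x \<notin> Z \<Longrightarrow> (gxx has_real_derivative w x) (at x)"
    by (auto simp: negligible_iff_null_sets)
  with g show thesis by (rule that)
qed

text \<open>Integrate three times, choosing each constant of integration so that the next primitive is again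
  periodic; the last constant is fixed by the mean \<open>m\<close>.\<close>

lemma ex_periodic_third_primitive:
  assumes w: "torus_fun w" "w absolutely_integrable_on {0..1}" "integral {0..1} w = 0"
  shows "\<exists>g. periodic_third_primitive m w g"
proof -
  have wI: "w integrable_on {0..1}" using w(2) by (simp add: absolutely_integrable_on_def)
  obtain F where F: "torus_fun F" "continuous_on UNIV F" "\<And>a b. a \<le> b \<Longrightarrow> F b - F a = integral {a..b} w"
    using periodic_indefinite_integral[OF w(1) wI w(3)] by blast
  define gxx where "gxx = (\<lambda>x. F x - integral {0..1} F)"
  have gxx: "torus_fun gxx" "continuous_on UNIV gxx" "\<And>a b. a \<le> b \<Longrightarrow> gxx b - gxx a = integral {a..b} w"
    using F by (auto simp: gxx_def torus_fun_def intro!: continuous_intros)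
  have FI: "F integrable_on {0..1}"
    using F(2) continuous_on_subset by (intro integrable_continuous_real) blast
  have "integral {0..1} gxx = integral {0..1} F - integral {0..1} (\<lambda>x::real. integral {0..1} F)"
    unfolding gxx_def by (intro integral_diff FI) (rule integrable_const_ivl)
  then have gxx0: "integral {0..1} gxx = 0" by simp
  obtain gx where gx: "\<And>x. (gx has_real_derivative gxx x) (at x)" "torus_fun gx" "integral {0..1} gx = 0"
    using periodic_primitive[OF gxx(2) gxx(1) gxx0, of 0] by blast
  have "continuous_on UNIV gx" using gx(1) by (meson DERIV_isCont continuous_at_imp_continuous_on)
  then obtain g where g: "\<And>x. (g has_real_derivative gx x) (at x)" "torus_fun g" "integral {0..1} g = m"
    using periodic_primitive[OF _ gx(2) gx(3), of m] by blast
  have ac: "absolutely_continuous_fun_on {0..1} gxx"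
    using absolutely_continuous_indefinite_integral[OF w(2)] gxx(3) by blast
  obtain Z where Z: "negligible Z" "\<And>x. x \<notin> Z \<Longrightarrow> (gxx has_real_derivative w x) (at x)"
    using AE_derivative_indefinite_integral[OF periodic_integrable[OF w(1) wI] gxx(3)] by blast
  have "AE x in lebesgue. (gxx has_real_derivative w x) (at x)"
    using Z by (intro AE_I'[of Z]) (auto simp: negligible_iff_null_sets)
  then have "periodic_third_primitive m w g"
    unfolding periodic_third_primitive_def using g gx gxx(1) ac by blast
  then show ?thesis by (intro exI[of _ g])
qed

text \<open>Periodicity fixes the constants of integration: in the uniqueness proof the difference of two
  second derivatives is a constant, which vanishes because the first derivatives are periodic, and
  likewise one level down.\<close>

lemma periodic_constant_derivative_eq_0:
  fixes f :: "real \<Rightarrow> real"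
  assumes "torus_fun f" "\<And>x. (f has_real_derivative f' x) (at x)" "\<And>x. x \<in> {0..1} \<Longrightarrow> f' x = c"
  shows "c = 0"
proof -
  obtain z where "0 < z" "z < 1" "f 1 - f 0 = (1 - 0) * f' z"
    using MVT2[of 0 1 f f'] assms(2) by auto
  moreover have "f 1 = f 0" using assms(1) unfolding torus_fun_def by (metis add_0)
  ultimately show "c = 0" using assms(3)[of z] by simp
qed

lemma periodic_third_primitive_unique:
  assumes "periodic_third_primitive m w g1" "periodic_third_primitive m w g2"
  shows "g1 = g2"
proof -
  obtain p1 q1 Z1 where 1: "torus_fun g1" "integral {0..1} g1 = m"
    "\<And>x. (g1 has_real_derivative p1 x) (at x)" "torus_fun p1"
    "\<And>x. (p1 has_real_derivative q1 x) (at x)" "torus_fun q1"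
    "absolutely_continuous_fun_on {0..1} q1"
    "negligible Z1" "\<And>x. x \<notin> Z1 \<Longrightarrow> (q1 has_real_derivative w x) (at x)"
    using periodic_third_primitiveE[OF assms(1)] by blast
  obtain p2 q2 Z2 where 2: "torus_fun g2" "integral {0..1} g2 = m"
    "\<And>x. (g2 has_real_derivative p2 x) (at x)" "torus_fun p2"
    "\<And>x. (p2 has_real_derivative q2 x) (at x)" "torus_fun q2"
    "absolutely_continuous_fun_on {0..1} q2"
    "negligible Z2" "\<And>x. x \<notin> Z2 \<Longrightarrow> (q2 has_real_derivative w x) (at x)"
    using periodic_third_primitiveE[OF assms(2)] by blast
  define g p q where "g = (\<lambda>x. g1 x - g2 x)" and "p = (\<lambda>x. p1 x - p2 x)" and "q = (\<lambda>x. q1 x - q2 x)"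
  have dg: "(g has_real_derivative p x) (at x)" and dp: "(p has_real_derivative q x) (at x)" for x
    unfolding g_def p_def q_def by (intro DERIV_diff 1 2)+
  have per: "torus_fun g" "torus_fun p" "torus_fun q"
    using 1 2 by (auto simp: g_def p_def q_def torus_fun_def)
  have "q x = q 0" if "x \<in> {0..1}" for x
  proof -
    have "absolutely_continuous_fun_on {0..x} q"
      unfolding q_def using that
      by (intro absolutely_continuous_subset[OF absolutely_continuous_diff[OF 1(7) 2(7)]]) auto
    moreover have "(q has_real_derivative 0) (at y)" if "y \<in> {0..x} - (Z1 \<union> Z2)" for y
      using DERIV_diff[OF 1(9)[of y] 2(9)[of y]] that by (simp add: q_def)
    ultimately have "((\<lambda>_. 0) has_integral (q x - q 0)) {0..x}"
      using that 1(8) 2(8) by (intro has_integral_absolutely_continuous[of _ _ _ "Z1 \<union> Z2"]) auto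
    then show ?thesis by (simp add: has_integral_0_eq)
  qed
  then have "q 0 = 0" using periodic_constant_derivative_eq_0[OF per(2) dp] by blast
  then have q0: "q x = 0" for x
    using \<open>\<And>x. x \<in> {0..1} \<Longrightarrow> q x = q 0\<close>[of "frac x"] periodic_frac[OF per(3), of x] frac_lt_1[of x]
    by simp
  then have p0: "p x = p 0" for x
    using dp by (intro DERIV_isconst_all) simp
  then have "p 0 = 0" using periodic_constant_derivative_eq_0[OF per(1) dg] by blast
  then have g0: "g x = g 0" for x
    using dg p0 by (intro DERIV_isconst_all) simp
  have I: "g1 integrable_on {0..1}" "g2 integrable_on {0..1}"
    using 1(3) 2(3) by (meson DERIV_isCont continuous_at_imp_continuous_on integrable_continuous_real)+
  have "integral {0..1} g = 0"
    unfolding g_def using integral_diff[OF I] 1(2) 2(2) by simp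
  moreover have "integral {0..1} g = integral {0..1} (\<lambda>x::real. g 0)"
    using g0 by (intro integral_cong) blast
  ultimately have "g 0 = 0" by simp
  then show ?thesis using g0 by (auto simp: g_def fun_eq_iff)
qed

lemma bounded_derivative_imp_lipschitz:
  fixes f f' :: "real \<Rightarrow> real"
  assumes "\<And>x. (f has_real_derivative f' x) (at x)" "\<And>x. x \<in> {a..b} \<Longrightarrow> \<bar>f' x\<bar> \<le> L"
    and "a \<le> x" "x \<le> y" "y \<le> b"
  shows "\<bar>f y - f x\<bar> \<le> L * (y - x)"
proof (cases "x = y")
  case False
  then obtain z where z: "x < z" "z < y" "f y - f x = (y - x) * f' z"
    using MVT2[of x y f f'] assms by force
  then have "\<bar>f y - f x\<bar> = (y - x) * \<bar>f' z\<bar>" using assms(4) by (simp add: abs_mult)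
  also have "\<dots> \<le> (y - x) * L" using z assms by (intro mult_left_mono assms(2)) auto
  finally show ?thesis by (simp add: mult.commute)
qed auto

lemma continuous_bounded_interval:
  fixes f :: "real \<Rightarrow> real"
  assumes "continuous_on {a..b} f"
  obtains B where "B \<ge> 0" "\<And>x. x \<in> {a..b} \<Longrightarrow> \<bar>f x\<bar> \<le> B"
proof -
  have "bounded (f ` {a..b})"
    using assms by (intro compact_imp_bounded compact_continuous_image) auto
  then obtain B where "\<forall>x\<in>{a..b}. \<bar>f x\<bar> \<le> B" by (auto simp: bounded_iff)
  then show thesis by (intro that[of "max B 0"]) fastforce+
qed

text \<open>All three integrations by parts at once: \<open>\<psi>2 g - \<psi>1 g\<^sub>x + \<psi> g\<^sub>x\<^sub>x\<close> has the integrand as its derivative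
  almost everywhere, since the intermediate products cancel, and it is periodic. It is absolutely
  continuous because \<open>g\<^sub>x\<^sub>x\<close> is and all other factors are Lipschitz on the unit interval.\<close>

lemma periodic_third_primitive_by_parts:
  assumes g: "periodic_third_primitive m w g"
    and \<psi>: "\<And>x. (\<psi> has_real_derivative \<psi>1 x) (at x)" "\<And>x. (\<psi>1 has_real_derivative \<psi>2 x) (at x)"
      "\<And>x. (\<psi>2 has_real_derivative \<psi>3 x) (at x)"
    and per: "torus_fun \<psi>" "torus_fun \<psi>1" "torus_fun \<psi>2"
    and cont: "continuous_on UNIV \<psi>3"
  shows "((\<lambda>x. \<psi>3 x * g x + \<psi> x * w x) has_integral 0) {0..1}"
proof -
  obtain p q Z where g: "torus_fun g" "integral {0..1} g = m"
    "\<And>x. (g has_real_derivative p x) (at x)" "torus_fun p"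
    "\<And>x. (p has_real_derivative q x) (at x)" "torus_fun q"
    and ac: "absolutely_continuous_fun_on {0..1} q"
    and Z: "negligible Z" "\<And>x. x \<notin> Z \<Longrightarrow> (q has_real_derivative w x) (at x)"
    using periodic_third_primitiveE[OF assms(1)] by blast
  have D: "continuous_on {0..1} f" if "\<And>x. (f has_real_derivative f' x) (at x)" for f f' :: "real \<Rightarrow> real"
    using that by (meson DERIV_isCont continuous_at_imp_continuous_on)
  have contq: "continuous_on {0..1} q" using absolutely_continuous_imp_continuous[OF ac] .
  define H H' where "H = (\<lambda>x. \<psi>2 x * g x - \<psi>1 x * p x)" and "H' = (\<lambda>x. \<psi>3 x * g x - \<psi>1 x * q x)"
  have dH: "(H has_real_derivative H' x) (at x)" for x
    unfolding H_def H'_def by (auto intro!: derivative_eq_intros \<psi> g simp: algebra_simps)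
  have "continuous_on {0..1} H'"
    unfolding H'_def
    by (intro continuous_on_diff continuous_on_mult D[OF g(3)] D[OF \<psi>(2)] contq
        continuous_on_subset[OF cont]) simp
  then obtain L where L: "L \<ge> 0" "\<And>x. x \<in> {0..1} \<Longrightarrow> \<bar>H' x\<bar> \<le> L"
    using continuous_bounded_interval by blast
  obtain A where A: "A \<ge> 0" "\<And>x. x \<in> {0..1} \<Longrightarrow> \<bar>\<psi> x\<bar> \<le> A"
    using continuous_bounded_interval[OF D[OF \<psi>(1)]] by blast
  obtain A1 where A1: "A1 \<ge> 0" "\<And>x. x \<in> {0..1} \<Longrightarrow> \<bar>\<psi>1 x\<bar> \<le> A1"
    using continuous_bounded_interval[OF D[OF \<psi>(2)]] by blast
  obtain Q where Q: "Q \<ge> 0" "\<And>x. x \<in> {0..1} \<Longrightarrow> \<bar>q x\<bar> \<le> Q"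
    using continuous_bounded_interval[OF contq] by blast
  define G where "G = (\<lambda>x. H x + \<psi> x * q x)"
  have acG: "absolutely_continuous_fun_on {0..1} G"
  proof (rule absolutely_continuous_dominated[OF ac A(1)])
    show "0 \<le> L + Q * A1" using L Q A1 by simp
    fix x y :: real assume "x \<le> y" and "{x..y} \<subseteq> {0..1}"
    then have xy: "0 \<le> x" "x \<le> y" "y \<le> 1" by auto
    have 1: "\<bar>H y - H x\<bar> \<le> L * (y - x)"
      by (rule bounded_derivative_imp_lipschitz[OF dH L(2) xy])
    have 2: "\<bar>\<psi> y - \<psi> x\<bar> \<le> A1 * (y - x)"
      by (rule bounded_derivative_imp_lipschitz[OF \<psi>(1) A1(2) xy])
    have "\<bar>\<psi> y * (q y - q x)\<bar> \<le> A * \<bar>q y - q x\<bar>"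
      using A(2)[of y] xy by (auto simp: abs_mult intro!: mult_right_mono)
    moreover have "\<bar>q x * (\<psi> y - \<psi> x)\<bar> \<le> Q * (A1 * (y - x))"
      unfolding abs_mult using Q xy 2 by (intro mult_mono) auto
    moreover have "G y - G x = (H y - H x) + \<psi> y * (q y - q x) + q x * (\<psi> y - \<psi> x)"
      by (simp add: G_def algebra_simps)
    ultimately show "\<bar>G y - G x\<bar> \<le> A * \<bar>q y - q x\<bar> + (L + Q * A1) * (y - x)"
      using 1 by (simp add: distrib_right mult.assoc)
  qed
  have "((\<lambda>x. \<psi>3 x * g x + \<psi> x * w x) has_integral (G 1 - G 0)) {0..1}"
  proof (rule has_integral_absolutely_continuous[OF _ acG Z(1)])
    fix x assume x: "x \<in> {0..1} - Z"
    show "(G has_real_derivative \<psi>3 x * g x + \<psi> x * w x) (at x)"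
      unfolding G_def using x by (auto intro!: derivative_eq_intros dH \<psi> Z(2) simp: H'_def)
  qed simp
  moreover have "f 1 = f 0" if "torus_fun f" for f using that unfolding torus_fun_def by (metis add_0)
  note this[OF per(1)] this[OF per(2)] this[OF per(3)] this[OF g(1)] this[OF g(4)] this[OF g(6)]
  then have "G 1 = G 0" by (simp add: G_def H_def)
  ultimately show ?thesis by simp
qed

text \<open>The continuous counterpart of the summation by parts: testing \<open>g\<close> with \<open>\<phi>\<close> only requires the mean of
  \<open>g\<close> and the integral of its third derivative against \<open>\<psi>\<close>.\<close>

lemma integral_periodic_third_primitive:
  assumes g: "periodic_third_primitive m w g" and \<phi>: "continuous_on UNIV \<phi>"
    and \<psi>: "\<And>x. (\<psi> has_real_derivative \<psi>1 x) (at x)" "\<And>x. (\<psi>1 has_real_derivative \<psi>2 x) (at x)"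
      "\<And>x. (\<psi>2 has_real_derivative (c - \<phi> x)) (at x)" "torus_fun \<psi>" "torus_fun \<psi>1" "torus_fun \<psi>2"
  shows "integral {0..1} (\<lambda>x. \<phi> x * g x) = c * m + integral {0..1} (\<lambda>x. \<psi> x * w x)"
proof -
  obtain gx where g': "integral {0..1} g = m" "\<And>x. (g has_real_derivative gx x) (at x)"
    using periodic_third_primitiveE[OF g] by blast
  have contg: "continuous_on {0..1} g" using g'(2) by (meson DERIV_isCont continuous_at_imp_continuous_on)
  have cont\<phi>: "continuous_on {0..1} \<phi>" using \<phi> continuous_on_subset by blast
  have 1: "(g has_integral m) {0..1}"
    using integrable_integral[OF integrable_continuous_real[OF contg]] g'(1) by simp
  have 2: "((\<lambda>x. \<phi> x * g x) has_integral integral {0..1} (\<lambda>x. \<phi> x * g x)) {0..1}"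
    by (intro integrable_integral integrable_continuous_real continuous_on_mult contg cont\<phi>)
  have 3: "((\<lambda>x. (c - \<phi> x) * g x + \<psi> x * w x) has_integral 0) {0..1}"
    by (rule periodic_third_primitive_by_parts[OF g \<psi>]) (intro continuous_intros \<phi>)
  have "((\<lambda>x. ((c - \<phi> x) * g x + \<psi> x * w x) - (c * g x - \<phi> x * g x)) has_integral
      0 - (c * m - integral {0..1} (\<lambda>x. \<phi> x * g x))) {0..1}"
    by (intro has_integral_diff 1 2 3 has_integral_mult_right)
  then have "((\<lambda>x. \<psi> x * w x) has_integral (integral {0..1} (\<lambda>x. \<phi> x * g x) - c * m)) {0..1}"
    by (simp add: algebra_simps)
  then show ?thesis by (simp add: integral_unique)
qed


section \<open>Differences on the periodic lattice\<close>

lemma sum_periodic_shift1: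
  fixes f :: "int \<Rightarrow> real"
  assumes "\<And>i. f (i + int N) = f i"
  shows "(\<Sum>i\<in>{1..int N}. f (i + 1)) = (\<Sum>i\<in>{1..int N}. f i)"
proof (cases "N = 0")
  case False
  have "(\<Sum>i\<in>{1..int N}. f (i + 1)) = (\<Sum>i\<in>{2..int N + 1}. f i)"
    by (rule sum.reindex_bij_witness[of _ "\<lambda>i. i - 1" "\<lambda>i. i + 1"]) auto
  also have "{2..int N + 1} = insert (int N + 1) {2..int N}" using False by auto
  also have "(\<Sum>i\<in>insert (int N + 1) {2..int N}. f i) = f 1 + (\<Sum>i\<in>{2..int N}. f i)"
    using assms[of 1] by (simp add: add.commute)
  also have "\<dots> = (\<Sum>i\<in>insert 1 {2..int N}. f i)" by simp
  also have "insert 1 {2..int N} = {1..int N}" using False by auto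
  finally show ?thesis .
qed simp

lemma sum_periodic_shift:
  fixes f :: "int \<Rightarrow> real"
  assumes "\<And>i. f (i + int N) = f i"
  shows "(\<Sum>i\<in>{1..int N}. f (i + k)) = (\<Sum>i\<in>{1..int N}. f i)"
proof -
  have up: "(\<Sum>i\<in>{1..int N}. g (i + int n)) = (\<Sum>i\<in>{1..int N}. g i)"
    if g: "\<And>i. g (i + int N) = g i" for g :: "int \<Rightarrow> real" and n
  proof (induction n)
    case (Suc n)
    have "(\<Sum>i\<in>{1..int N}. g (i + int (Suc n))) = (\<Sum>i\<in>{1..int N}. (\<lambda>i. g (i + int n)) (i + 1))"
      by (simp add: algebra_simps)
    also have "\<dots> = (\<Sum>i\<in>{1..int N}. g (i + int n))"
      using g by (intro sum_periodic_shift1) (metis add.assoc add.commute)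
    finally show ?case using Suc by simp
  qed simp
  show ?thesis
  proof (cases "k \<ge> 0")
    case True
    then show ?thesis using up[where g = f and n = "nat k"] assms by simp
  next
    case False
    have "f (i + int N + k) = f (i + k)" for i
      using assms[of "i + k"] by (simp add: add.commute add.left_commute)
    then have "(\<Sum>i\<in>{1..int N}. f (i + int (nat (- k)) + k)) = (\<Sum>i\<in>{1..int N}. f (i + k))"
      by (rule up)
    with False show ?thesis by simp
  qed
qed

text \<open>A discrete Poincare inequality. The oscillation of \<open>f\<close> is at most its total variation around
  the circle, and \<open>f i\<close> is the average over \<open>j\<close> of \<open>f i - f j\<close> as the mean of \<open>f\<close> is zero.\<close>

lemma periodic_mean_zero_bound:
  fixes f :: "int \<Rightarrow> real"
  assumes per: "\<And>i. f (i + int N) = f i" and 0: "(\<Sum>i\<in>{1..int N}. f i) = 0"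
    and i: "i \<in> {1..int N}"
  shows "\<bar>f i\<bar> \<le> (\<Sum>j\<in>{1..int N}. \<bar>f (j + 1) - f j\<bar>)" (is "_ \<le> ?V")
proof -
  have le: "\<bar>f b - f a\<bar> \<le> ?V" if "1 \<le> a" "a \<le> b" "b \<le> int N" for a b
  proof -
    have "f b - f a = (\<Sum>j\<in>{a..<b}. f (j + 1) - f j)"
      using \<open>a \<le> b\<close>
    proof (induction b rule: int_ge_induct)
      case (step b)
      then have "{a..<b + 1} = insert b {a..<b}" by auto
      with step show ?case by simp
    qed simp
    also have "\<bar>\<dots>\<bar> \<le> (\<Sum>j\<in>{a..<b}. \<bar>f (j + 1) - f j\<bar>)" by (rule sum_abs)
    also have "\<dots> \<le> ?V" using that by (intro sum_mono2) auto
    finally show ?thesis .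
  qed
  have "real N * f i = (\<Sum>j\<in>{1..int N}. f i - f j)"
    using 0 by (simp add: sum_subtractf)
  then have "real N * \<bar>f i\<bar> = \<bar>\<Sum>j\<in>{1..int N}. f i - f j\<bar>"
    by (metis abs_mult abs_of_nat)
  also have "\<dots> \<le> (\<Sum>j\<in>{1..int N}. \<bar>f i - f j\<bar>)" by (rule sum_abs)
  also have "\<dots> \<le> (\<Sum>j\<in>{1..int N}. ?V)"
  proof (rule sum_mono)
    fix j assume "j \<in> {1..int N}"
    then show "\<bar>f i - f j\<bar> \<le> ?V"
      using le[of i j] le[of j i] i by (cases "i \<le> j") (auto simp: abs_minus_commute)
  qed
  also have "\<dots> = real N * ?V" by simp
  finally show ?thesis using i by (cases "N = 0") auto
qed

text \<open>Three applications of the Poincare inequality: differences of periodic functions have mean zero, so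
  only the heights themselves need to be centred. Each of the last two applications costs a factor \<open>N\<close>. After
  division by \<open>N\<^sup>3\<close> the bound becomes the scaled mean height plus the average of \<open>\<bar>w\<^sub>i\<bar>\<close>, both of
  which are bounded in probability.\<close>

lemma height_bound:
  fixes h :: "int \<Rightarrow> int"
  assumes h: "h \<in> profiles N" and i: "i \<in> {1..int N}"
  shows "\<bar>real_of_int (h i)\<bar> \<le> \<bar>\<Sum>j\<in>{1..int N}. real_of_int (h j)\<bar> / real N
           + real N ^ 2 * (\<Sum>j\<in>{1..int N}. \<bar>real_of_int (third_diff h j)\<bar>)"
proof -
  have N: "N > 0" using i by (cases N) auto
  have per: "h (i + int N) = h i" for i using h by (simp add: profiles_def)
  define A where "A = (\<Sum>j\<in>{1..int N}. real_of_int (h j)) / real N"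
  define f0 where "f0 = (\<lambda>i. real_of_int (h i) - A)"
  define f1 where "f1 = (\<lambda>i. f0 (i + 1) - f0 i)"
  define f2 where "f2 = (\<lambda>i. f1 (i + 1) - f1 i)"
  define W where "W = (\<Sum>j\<in>{1..int N}. \<bar>f2 (j + 1) - f2 j\<bar>)"
  have p0: "f0 (i + int N) = f0 i" for i by (simp add: f0_def per)
  have p1: "f1 (i + int N) = f1 i" for i using p0[of i] p0[of "i + 1"] by (simp add: f1_def algebra_simps)
  have p2: "f2 (i + int N) = f2 i" for i using p1[of i] p1[of "i + 1"] by (simp add: f2_def algebra_simps)
  have s0: "(\<Sum>i\<in>{1..int N}. f0 i) = 0" using N by (simp add: f0_def A_def sum_subtractf)
  have s1: "(\<Sum>i\<in>{1..int N}. f1 i) = 0"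
    using sum_periodic_shift1[of f0 N] p0 by (simp add: f1_def sum_subtractf)
  have s2: "(\<Sum>i\<in>{1..int N}. f2 i) = 0"
    using sum_periodic_shift1[of f1 N] p1 by (simp add: f2_def sum_subtractf)
  have b2: "\<bar>f2 j\<bar> \<le> W" if "j \<in> {1..int N}" for j
    unfolding W_def by (rule periodic_mean_zero_bound[OF p2 s2 that])
  have b1: "\<bar>f1 j\<bar> \<le> real N * W" if "j \<in> {1..int N}" for j
  proof -
    have "\<bar>f1 j\<bar> \<le> (\<Sum>j\<in>{1..int N}. \<bar>f2 j\<bar>)"
      using periodic_mean_zero_bound[OF p1 s1 that] by (simp add: f2_def)
    also have "\<dots> \<le> (\<Sum>j\<in>{1..int N}. W)" by (intro sum_mono b2)
    finally show ?thesis by simp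
  qed
  have "\<bar>f0 i\<bar> \<le> (\<Sum>j\<in>{1..int N}. \<bar>f1 j\<bar>)"
    using periodic_mean_zero_bound[OF p0 s0 i] by (simp add: f1_def)
  also have "\<dots> \<le> (\<Sum>j\<in>{1..int N}. real N * W)" by (intro sum_mono b1)
  finally have "\<bar>f0 i\<bar> \<le> real N ^ 2 * W" by (simp add: power2_eq_square)
  moreover have "W = (\<Sum>j\<in>{1..int N}. \<bar>real_of_int (third_diff h j)\<bar>)"
  proof -
    have "f2 (j + 1) - f2 j = real_of_int (third_diff h (j + 1))" for j
      by (simp add: third_diff_eq f2_def f1_def f0_def algebra_simps)
    then have "W = (\<Sum>j\<in>{1..int N}. \<bar>real_of_int (third_diff h (j + 1))\<bar>)" by (simp add: W_def)
    also have "\<dots> = (\<Sum>j\<in>{1..int N}. \<bar>real_of_int (third_diff h j)\<bar>)"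
    proof (rule sum_periodic_shift1)
      fix i
      show "\<bar>real_of_int (third_diff h (i + int N))\<bar> = \<bar>real_of_int (third_diff h i)\<bar>"
        using per[of i] per[of "i + 1"] per[of "i + 2"] per[of "i - 1"]
        by (simp add: third_diff_eq algebra_simps)
    qed
    finally show ?thesis .
  qed
  moreover have "\<bar>real_of_int (h i)\<bar> \<le> \<bar>A\<bar> + \<bar>f0 i\<bar>" by (simp add: f0_def)
  ultimately show ?thesis by (simp add: A_def)
qed

text \<open>The adjoint of the third difference operator on the periodic lattice, obtained by shifting the
  summation index of each of its four terms.\<close>

lemma sum_third_diff_by_parts:
  fixes h :: "int \<Rightarrow> int" and p :: "int \<Rightarrow> real"
  assumes h: "h \<in> profiles N" and p: "\<And>i. p (i + int N) = p i"
  shows "(\<Sum>i\<in>{1..int N}. p i * real_of_int (third_diff h i))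
       = (\<Sum>i\<in>{1..int N}. (p (i - 2) - 3 * p (i - 1) + 3 * p i - p (i + 1)) * real_of_int (h i))"
proof -
  have per: "h (i + int N) = h i" for i using h by (simp add: profiles_def)
  have shift: "(\<Sum>i\<in>{1..int N}. p i * real_of_int (h (i + k))) = (\<Sum>i\<in>{1..int N}. p (i - k) * real_of_int (h i))" for k
  proof -
    have "p (i - k + int N) * real_of_int (h (i + int N)) = p (i - k) * real_of_int (h i)" for i
      by (simp only: p per)
    then have "p (i + int N - k) * real_of_int (h (i + int N)) = p (i - k) * real_of_int (h i)" for i
      by (simp add: algebra_simps)
    from sum_periodic_shift[of "\<lambda>i. p (i - k) * real_of_int (h i)", OF this, of k]
    show ?thesis by simp
  qed
  have "(\<Sum>i\<in>{1..int N}. p i * real_of_int (third_diff h i))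
      = (\<Sum>i\<in>{1..int N}. p i * real_of_int (h (i + 2))) - 3 * (\<Sum>i\<in>{1..int N}. p i * real_of_int (h (i + 1)))
        + 3 * (\<Sum>i\<in>{1..int N}. p i * real_of_int (h i)) - (\<Sum>i\<in>{1..int N}. p i * real_of_int (h (i + (-1))))"
    by (simp add: third_diff_eq sum_subtractf sum.distrib sum_distrib_left algebra_simps)
  also have "\<dots> = (\<Sum>i\<in>{1..int N}. (p (i - 2) - 3 * p (i - 1) + 3 * p i - p (i + 1)) * real_of_int (h i))"
    unfolding shift by (simp add: sum_subtractf sum.distrib sum_distrib_left algebra_simps)
  finally show ?thesis .
qed

lemma sum_third_diff_eq_0:
  assumes "h \<in> profiles N"
  shows "(\<Sum>i\<in>{1..int N}. of_int (third_diff h i)) = (0 :: real)"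
  using sum_third_diff_by_parts[OF assms, of "\<lambda>_. 1"] by simp

text \<open>The operator on the left is minus a third-order forward difference, so the mean value theorem can be
  applied to it three times, each time trading one difference for a derivative.\<close>

lemma third_difference_mean_value:
  fixes f :: "real \<Rightarrow> real"
  assumes f: "\<And>x. (f has_real_derivative f1 x) (at x)" "\<And>x. (f1 has_real_derivative f2 x) (at x)"
      "\<And>x. (f2 has_real_derivative f3 x) (at x)" and "d > 0"
  obtains y where "\<bar>y - x\<bar> \<le> 2 * d"
    "f (x - 2 * d) - 3 * f (x - d) + 3 * f x - f (x + d) = - (d ^ 3) * f3 y"
proof -
  have shift: "((\<lambda>x. g (x + c)) has_real_derivative g' (x + c)) (at x)"
    if "\<And>x. (g has_real_derivative g' x) (at x)" for g g' :: "real \<Rightarrow> real" and c x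
    using that[of "x + c"] by (simp add: DERIV_shift)
  have mv: "\<exists>z. x < z \<and> z < x + d \<and> g (x + d) - g x = d * g' z"
    if "\<And>x. (g has_real_derivative g' x) (at x)" for g g' :: "real \<Rightarrow> real" and x
    using MVT2[of x "x + d" g g'] that \<open>d > 0\<close> by auto
  let ?D = "\<lambda>g x. g (x + d) - (g x :: real)"
  let ?D2 = "\<lambda>g x. g (x + 2 * d) - 2 * g (x + d) + (g x :: real)"
  have D1: "(?D g has_real_derivative ?D g' x) (at x)"
    if "\<And>x. (g has_real_derivative g' x) (at x)" for g g' :: "real \<Rightarrow> real" and x
    by (intro DERIV_diff shift that)
  have D2: "(?D2 g has_real_derivative ?D2 g' x) (at x)"
    if "\<And>x. (g has_real_derivative g' x) (at x)" for g g' :: "real \<Rightarrow> real" and x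
    by (intro DERIV_diff DERIV_add DERIV_cmult shift that)
  \<comment> \<open>The outer two differences are kept while the first one is resolved, then one, then none.\<close>
  obtain z1 where z1: "x - 2 * d < z1" "z1 < x - d" "?D2 f (x - d) - ?D2 f (x - 2 * d) = d * ?D2 f1 z1"
    using mv[OF D2[OF f(1)], of "x - 2 * d"] by (auto simp: algebra_simps)
  obtain z2 where z2: "z1 < z2" "z2 < z1 + d" "?D f1 (z1 + d) - ?D f1 z1 = d * ?D f2 z2"
    using mv[OF D1[OF f(2)], of z1] by auto
  obtain z3 where z3: "z2 < z3" "z3 < z2 + d" "f2 (z2 + d) - f2 z2 = d * f3 z3"
    using mv[OF f(3), of z2] by auto
  have "?D2 f1 z1 = d * (d * f3 z3)" using z2(3) z3(3) by (simp add: algebra_simps)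
  then have "f (x + d) - 3 * f x + 3 * f (x - d) - f (x - 2 * d) = d ^ 3 * f3 z3"
    using z1(3) by (simp add: algebra_simps power3_eq_cube)
  then show thesis using z1 z2 z3 \<open>d > 0\<close> by (intro that[of z3]) auto
qed

text \<open>Summation by parts moves the third difference from \<open>h\<close> to \<open>\<psi>\<close>, where it becomes \<open>1 / N ^ 3\<close> times \<open>\<phi> - c\<close>
  at a point within \<open>2 / N\<close> of the lattice point. The resulting error carries the modulus of continuity
  \<open>\<delta>\<close> of \<open>\<phi>\<close> as a factor and is multiplied by \<open>\<bar>h i\<bar> / N ^ 3\<close>, which the discrete Poincare inequality
  bounds uniformly in \<open>i\<close>.\<close>

lemma test_function_estimate:
  fixes h :: "int \<Rightarrow> int" and \<phi> \<psi> :: "real \<Rightarrow> real"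
  assumes h: "h \<in> profiles N" and N: "N \<ge> 1"
    and \<psi>: "\<And>x. (\<psi> has_real_derivative \<psi>1 x) (at x)" "\<And>x. (\<psi>1 has_real_derivative \<psi>2 x) (at x)"
      "\<And>x. (\<psi>2 has_real_derivative (c - \<phi> x)) (at x)" "torus_fun \<psi>"
    and \<delta>: "\<And>x y. \<bar>x - y\<bar> \<le> 2 / real N \<Longrightarrow> \<bar>\<phi> x - \<phi> y\<bar> \<le> \<delta>"
  defines "A \<equiv> 1 / real N * (\<Sum>i\<in>{1..int N}. real N powr (- 3) * of_int (h i))"
    and "B \<equiv> 1 / real N * (\<Sum>i\<in>{1..int N}. \<psi> (of_int i / real N) * of_int (third_diff h i))"
    and "W \<equiv> 1 / real N * (\<Sum>i\<in>{1..int N}. \<bar>of_int (third_diff h i)\<bar>)"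
  shows "\<bar>1 / real N * (\<Sum>i\<in>{1..int N}. \<phi> (of_int i / real N) * real N powr (- 3) * of_int (h i)) - c * A - B\<bar>
      \<le> \<delta> * (W + \<bar>A\<bar>)"
proof -
  have pw: "real N powr (- 3) = 1 / real N ^ 3"
    using N powr_realpow[of "real N" 3] by (simp add: powr_minus divide_inverse)
  have \<delta>0: "0 \<le> \<delta>" using \<delta>[of 0 0] N by auto
  define p where "p = (\<lambda>i::int. \<psi> (of_int i / real N))"
  have pper: "p (i + int N) = p i" for i
    using \<psi>(4) N by (simp add: p_def add_divide_distrib torus_fun_def)
  have "\<exists>y. \<bar>y - of_int i / real N\<bar> \<le> 2 / real N \<and>
      p (i - 2) - 3 * p (i - 1) + 3 * p i - p (i + 1) = (\<phi> y - c) * real N powr (- 3)" for i :: int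
  proof -
    have d: "1 / real N > 0" using N by simp
    obtain y where y: "\<bar>y - of_int i / real N\<bar> \<le> 2 * (1 / real N)"
      "\<psi> (of_int i / real N - 2 * (1 / real N)) - 3 * \<psi> (of_int i / real N - 1 / real N)
         + 3 * \<psi> (of_int i / real N) - \<psi> (of_int i / real N + 1 / real N) = - ((1 / real N) ^ 3) * (c - \<phi> y)"
      using third_difference_mean_value[OF \<psi>(1-3) d] by metis
    have p_eq: "p i = \<psi> (of_int i / real N)" "p (i - 2) = \<psi> (of_int i / real N - 2 * (1 / real N))"
      "p (i - 1) = \<psi> (of_int i / real N - 1 / real N)"
      "p (i + 1) = \<psi> (of_int i / real N + 1 / real N)"
      by (simp_all add: p_def diff_divide_distrib add_divide_distrib)
    have "- ((1 / real N) ^ 3) * (c - \<phi> y) = (\<phi> y - c) * real N powr (- 3)"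
      by (simp add: pw power_divide left_diff_distrib diff_divide_distrib)
    then have "p (i - 2) - 3 * p (i - 1) + 3 * p i - p (i + 1) = (\<phi> y - c) * real N powr (- 3)"
      using y(2) by (simp only: p_eq)
    with y(1) show ?thesis by auto
  qed
  then obtain y where y: "\<And>i. \<bar>y i - of_int i / real N\<bar> \<le> 2 / real N"
    "\<And>i. p (i - 2) - 3 * p (i - 1) + 3 * p i - p (i + 1) = (\<phi> (y i) - c) * real N powr (- 3)"
    by metis
  have B: "B = 1 / real N * (\<Sum>i\<in>{1..int N}. (\<phi> (y i) - c) * real N powr (- 3) * of_int (h i))"
    using sum_third_diff_by_parts[where p = p, OF h pper] unfolding B_def y(2) by (simp only: p_def)
  have hb: "real N powr (- 3) * \<bar>of_int (h i)\<bar> \<le> W + \<bar>A\<bar>" if "i \<in> {1..int N}" for i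
  proof -
    have "real N powr (- 3) * \<bar>of_int (h i)\<bar> \<le> real N powr (- 3) *
        (\<bar>\<Sum>j\<in>{1..int N}. real_of_int (h j)\<bar> / real N
           + real N ^ 2 * (\<Sum>j\<in>{1..int N}. \<bar>real_of_int (third_diff h j)\<bar>))"
      by (intro mult_left_mono height_bound[OF h that]) simp
    also have "\<dots> = W + \<bar>A\<bar>"
    proof -
      have "A = (\<Sum>j\<in>{1..int N}. real_of_int (h j)) / real N * (1 / real N ^ 3)"
        by (simp add: A_def pw sum_divide_distrib[symmetric])
      then have "\<bar>A\<bar> = \<bar>\<Sum>j\<in>{1..int N}. real_of_int (h j)\<bar> / real N * (1 / real N ^ 3)"
        by (simp add: abs_mult)
      moreover have "1 / real N ^ 3 * real N ^ 2 = 1 / real N"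
        using N by (simp add: power3_eq_cube power2_eq_square)
      ultimately show ?thesis
        unfolding pw W_def distrib_left mult.assoc[symmetric] by (simp only: mult.commute add.commute)
    qed
    finally show ?thesis .
  qed
  have "1 / real N * (\<Sum>i\<in>{1..int N}. \<phi> (of_int i / real N) * real N powr (- 3) * of_int (h i)) - c * A - B
     = 1 / real N * (\<Sum>i\<in>{1..int N}. (\<phi> (of_int i / real N) - \<phi> (y i)) * (real N powr (- 3) * of_int (h i)))"
    unfolding A_def B by (simp add: sum_distrib_left sum_subtractf[symmetric] algebra_simps)
  also have "\<bar>\<dots>\<bar> \<le> 1 / real N * (\<Sum>i\<in>{1..int N}. \<delta> * (W + \<bar>A\<bar>))"
    unfolding abs_mult
  proof (intro mult_mono)
    show "\<bar>\<Sum>i\<in>{1..int N}. (\<phi> (of_int i / real N) - \<phi> (y i)) * (real N powr (- 3) * of_int (h i))\<bar>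
        \<le> (\<Sum>i\<in>{1..int N}. \<delta> * (W + \<bar>A\<bar>))"
    proof (intro order_trans[OF sum_abs] sum_mono)
      fix i assume i: "i \<in> {1..int N}"
      have "\<bar>\<phi> (of_int i / real N) - \<phi> (y i)\<bar> \<le> \<delta>"
        using y(1)[of i] by (intro \<delta>) (simp add: abs_minus_commute)
      then show "\<bar>(\<phi> (of_int i / real N) - \<phi> (y i)) * (real N powr (- 3) * of_int (h i))\<bar> \<le> \<delta> * (W + \<bar>A\<bar>)"
        unfolding abs_mult using hb[OF i] \<delta>0 by (intro mult_mono) (auto simp: abs_mult)
    qed
  qed auto
  also have "\<dots> = \<delta> * (W + \<bar>A\<bar>)" using N by simp
  finally show ?thesis .
qed


section \<open>Conservation of the total height\<close>

text \<open>Summing over the actual targets of \<open>x\<close> together with \<open>x\<close> itself, which is the only target if \<open>x\<close> is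
  absorbing.\<close>

lemma sum_jump_prob:
  assumes fin: "finite {y. q x y \<noteq> 0}"
  shows "(\<Sum>y\<in>insert x {y. q x y \<noteq> 0}. jump_prob q x y) = 1"
proof (cases "exit_rate q x = 0")
  case True
  then have "(\<Sum>y\<in>insert x {y. q x y \<noteq> 0}. jump_prob q x y) = (\<Sum>y\<in>insert x {y. q x y \<noteq> 0}. if y = x then 1 else 0)"
    by (intro sum.cong) (auto simp: jump_prob_def)
  then show ?thesis using fin by simp
next
  case False
  have ex: "exit_rate q x = (\<Sum>y\<in>{y. q x y \<noteq> 0} - {x}. q x y)"
  proof -
    have "(\<Sum>\<^sub>\<infinity>y\<in>- {x}. q x y) = (\<Sum>\<^sub>\<infinity>y\<in>{y. q x y \<noteq> 0} - {x}. q x y)"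
      by (rule infsum_cong_neutral) auto
    then show ?thesis using fin by (simp add: exit_rate_def)
  qed
  have "(\<Sum>y\<in>insert x {y. q x y \<noteq> 0}. jump_prob q x y)
      = jump_prob q x x + (\<Sum>y\<in>{y. q x y \<noteq> 0} - {x}. jump_prob q x y)"
    using fin by (simp add: sum.insert_remove)
  also have "jump_prob q x x = 0" using False by (simp add: jump_prob_def)
  also have "(\<Sum>y\<in>{y. q x y \<noteq> 0} - {x}. jump_prob q x y) = (\<Sum>y\<in>{y. q x y \<noteq> 0} - {x}. q x y / exit_rate q x)"
    using False by (intro sum.cong) (auto simp: jump_prob_def)
  also have "\<dots> = 1" using False ex by (simp add: sum_divide_distrib[symmetric])
  finally show ?thesis by simp
qed

text \<open>For holding times \<open>R\<close> of a process without explosion: the time \<open>t\<close> falls into the holding interval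
  of some state of the jump chain.\<close>

lemma ennreal_partial_sums_straddle:
  fixes R :: "nat \<Rightarrow> ennreal"
  assumes "(\<Sum>n. R n) = \<infinity>"
  obtains n where "(\<Sum>k<n. R k) \<le> ennreal t" "ennreal t < (\<Sum>k<Suc n. R k)"
proof -
  have "\<exists>n. ennreal t < (\<Sum>k<n. R k)"
  proof (rule ccontr)
    assume "\<not> ?thesis"
    then have "(\<Sum>k<n. R k) \<le> ennreal t" for n by (simp add: not_less)
    then have "(\<Sum>n. R n) \<le> ennreal t" by (simp add: suminf_le_const)
    with assms show False by (simp add: top_unique)
  qed
  then obtain n where n: "ennreal t < (\<Sum>k<n. R k)" "\<And>m. m < n \<Longrightarrow> \<not> ennreal t < (\<Sum>k<m. R k)"
    using exists_least_iff[of "\<lambda>n. ennreal t < (\<Sum>k<n. R k)"] by blast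
  then obtain m where m: "n = Suc m" by (cases n) auto
  with n show thesis by (intro that[of m]) (auto simp: not_less)
qed

text \<open>A function of the state that is unchanged by every jump of positive rate is almost surely constant in
  time. The law of the jump chain is only given on events where all holding times so far are
  positive, so the positivity has to be carried through the induction: given a history \<open>y\<close>, the
  probabilities of the finitely many admissible continuations with \<open>R n > 0\<close> already add up to that of the
  history, which leaves no mass for \<open>R n = 0\<close> or for an inadmissible jump. Countability of \<open>S\<close> allows all
  histories to be treated simultaneously.\<close>

lemma markov_jump_process_invariant:
  fixes q :: "'s \<Rightarrow> 's \<Rightarrow> real" and I :: "'s \<Rightarrow> 'b"
  assumes X: "markov_jump_process S q P X" and S: "countable S"
    and fin: "\<And>x. x \<in> S \<Longrightarrow> finite {y. q x y \<noteq> 0}"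
    and inv: "\<And>x y. \<lbrakk>x \<in> S; q x y \<noteq> 0\<rbrakk> \<Longrightarrow> y \<in> S \<and> I y = I x"
    and st: "0 \<le> s" "0 \<le> t"
  shows "AE \<omega> in P. I (X s \<omega>) = I (X t \<omega>)"
proof -
  interpret prob_space P using X by (simp add: markov_jump_process_def)
  obtain Y R where Y: "\<And>n. Y n \<in> measurable P (count_space S)"
    and R: "\<And>n. R n \<in> borel_measurable P"
    and law: "\<And>n y s. \<lbrakk>\<And>k. k \<le> n \<Longrightarrow> y k \<in> S; \<And>k. k < n \<Longrightarrow> 0 \<le> s k\<rbrakk> \<Longrightarrow>
           prob {\<omega> \<in> space P. (\<forall>k\<le>n. Y k \<omega> = y k) \<and> (\<forall>k<n. ennreal (s k) < R k \<omega>)}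
           = prob {\<omega> \<in> space P. Y 0 \<omega> = y 0}
             * (\<Prod>k<n. exp (- exit_rate q (y k) * s k) * jump_prob q (y k) (y (Suc k)))"
    and ae: "AE \<omega> in P. (\<Sum>n. R n \<omega>) = \<infinity> \<and>
           (\<forall>n. \<forall>t\<ge>0. (\<Sum>k<n. R k \<omega>) \<le> ennreal t \<and> ennreal t < (\<Sum>k<Suc n. R k \<omega>)
              \<longrightarrow> X t \<omega> = Y n \<omega>)"
    using X unfolding markov_jump_process_def by blast
  note [measurable] = R
  have Ym [measurable]: "{\<omega> \<in> space P. Y n \<omega> = y} \<in> sets P" for n y
  proof (cases "y \<in> S")
    case True
    then have "Y n -` {y} \<inter> space P \<in> sets P" using Y[of n] by (intro measurable_sets[of _ _ "count_space S"]) auto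
    also have "Y n -` {y} \<inter> space P = {\<omega> \<in> space P. Y n \<omega> = y}" by auto
    finally show ?thesis .
  next
    case False
    then have "{\<omega> \<in> space P. Y n \<omega> = y} = {}" using measurable_space[OF Y[of n]] by auto
    then show ?thesis by (simp only: sets.empty_sets)
  qed
  define E where "E = (\<lambda>n y. {\<omega> \<in> space P. (\<forall>k\<le>n. Y k \<omega> = y k) \<and> (\<forall>k<n. 0 < R k \<omega>)})"
  have Em [measurable]: "E n y \<in> sets P" for n y unfolding E_def by measurable
  have PE: "prob (E n y) = prob {\<omega> \<in> space P. Y 0 \<omega> = y 0} * (\<Prod>k<n. jump_prob q (y k) (y (Suc k)))"
    if "\<And>k. k \<le> n \<Longrightarrow> y k \<in> S" for n y
    using law[of n y "\<lambda>_. 0"] that by (simp add: E_def)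
  have step: "AE \<omega> in P. \<omega> \<in> E n y \<longrightarrow> 0 < R n \<omega> \<and> I (Y (Suc n) \<omega>) = I (y n)"
    if y: "\<And>k. k \<le> n \<Longrightarrow> y k \<in> S" for n y
  proof -
    have PEy: "prob (E n y) = prob {\<omega> \<in> space P. Y 0 \<omega> = y 0} * (\<Prod>k<n. jump_prob q (y k) (y (Suc k)))"
      by (rule PE) (rule y)
    define C where "C = insert (y n) {z. q (y n) z \<noteq> 0}"
    have C: "finite C" "\<And>z. z \<in> C \<Longrightarrow> z \<in> S \<and> I z = I (y n)"
      using fin[of "y n"] inv[of "y n"] y[of n] by (auto simp: C_def)
    define U where "U = (\<Union>z\<in>C. E (Suc n) (y(Suc n := z)))"
    have U: "U \<in> sets P" unfolding U_def using C(1) by (intro sets.finite_UN) auto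
    have sub: "U \<subseteq> E n y" by (force simp: U_def E_def less_Suc_eq_le)
    have "prob U = (\<Sum>z\<in>C. prob (E (Suc n) (y(Suc n := z))))"
      unfolding U_def
    proof (rule finite_measure_finite_Union[OF C(1)])
      show "disjoint_family_on (\<lambda>z. E (Suc n) (y(Suc n := z))) C"
        by (fastforce simp: disjoint_family_on_def E_def)
    qed auto
    also have "\<dots> = (\<Sum>z\<in>C. prob (E n y) * jump_prob q (y n) z)"
    proof (rule sum.cong[OF refl])
      fix z assume z: "z \<in> C"
      have "prob (E (Suc n) (y(Suc n := z))) = prob {\<omega> \<in> space P. Y 0 \<omega> = y 0} *
          (\<Prod>k<Suc n. jump_prob q ((y(Suc n := z)) k) ((y(Suc n := z)) (Suc k)))"
        using y C(2)[OF z] by (subst PE) (auto simp: le_Suc_eq)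
      also have "(\<Prod>k<Suc n. jump_prob q ((y(Suc n := z)) k) ((y(Suc n := z)) (Suc k)))
          = (\<Prod>k<n. jump_prob q (y k) (y (Suc k))) * jump_prob q (y n) z"
        by simp
      finally show "prob (E (Suc n) (y(Suc n := z))) = prob (E n y) * jump_prob q (y n) z"
        unfolding PEy by (simp only: mult.assoc)
    qed
    also have "\<dots> = prob (E n y)"
      using sum_jump_prob[of q "y n"] fin[of "y n"] y[of n] by (simp add: C_def sum_distrib_left[symmetric])
    finally have "prob (E n y - U) = 0"
      using finite_measure_Diff[OF Em U sub] by simp
    then have out: "AE \<omega> in P. \<omega> \<notin> E n y - U"
      using U by (intro AE_not_in) (auto simp: null_sets_def emeasure_eq_measure)
    have good: "0 < R n \<omega> \<and> I (Y (Suc n) \<omega>) = I (y n)" if \<omega>: "\<omega> \<in> U" for \<omega>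
    proof -
      obtain z where z: "z \<in> C" "\<omega> \<in> E (Suc n) (y(Suc n := z))" using \<omega> unfolding U_def by blast
      then have "Y (Suc n) \<omega> = z" "0 < R n \<omega>" unfolding E_def by auto
      with C(2)[OF z(1)] show ?thesis by simp
    qed
    show ?thesis using out by eventually_elim (use good in blast)
  qed
  have "AE \<omega> in P. \<forall>k<n. 0 < R k \<omega> \<and> I (Y (Suc k) \<omega>) = I (Y k \<omega>)" for n
  proof (induction n)
    case (Suc n)
    have "countable {xs. set xs \<subseteq> S}"
      using countable_lists[OF S] by (simp add: lists_eq_set)
    then have "AE \<omega> in P. \<forall>xs\<in>{xs. set xs \<subseteq> S \<and> length xs = Suc n}. \<omega> \<in> E n (\<lambda>k. xs ! k) \<longrightarrow>
        0 < R n \<omega> \<and> I (Y (Suc n) \<omega>) = I (xs ! n)"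
    proof (intro AE_ball_countable[THEN iffD2])
      show "countable {xs. set xs \<subseteq> S \<and> length xs = Suc n}"
        using \<open>countable {xs. set xs \<subseteq> S}\<close> by (rule countable_subset[rotated]) auto
      show "\<forall>xs\<in>{xs. set xs \<subseteq> S \<and> length xs = Suc n}. AE \<omega> in P. \<omega> \<in> E n (\<lambda>k. xs ! k) \<longrightarrow>
        0 < R n \<omega> \<and> I (Y (Suc n) \<omega>) = I (xs ! n)"
        by (intro ballI step) (auto simp: subset_iff)
    qed
    with Suc show ?case
      using AE_space
    proof eventually_elim
      case (elim \<omega>)
      define xs where "xs = map (\<lambda>k. Y k \<omega>) [0..<Suc n]"
      have xs: "xs ! k = Y k \<omega>" if "k \<le> n" for k
        unfolding xs_def using that by (subst nth_map) (auto simp del: upt_Suc)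
      have "set xs \<subseteq> S" "length xs = Suc n"
        using measurable_space[OF Y elim(3)] by (auto simp: xs_def)
      moreover have "\<omega> \<in> E n (\<lambda>k. xs ! k)"
        using elim(1,3) xs by (auto simp: E_def)
      ultimately have "0 < R n \<omega> \<and> I (Y (Suc n) \<omega>) = I (Y n \<omega>)"
        using elim(2) xs[of n] by auto
      then show ?case using elim(1) by (auto simp: less_Suc_eq)
    qed
  qed simp
  then have "AE \<omega> in P. \<forall>n. \<forall>k<n. 0 < R k \<omega> \<and> I (Y (Suc k) \<omega>) = I (Y k \<omega>)"
    by (simp add: AE_all_countable)
  with ae show ?thesis
  proof eventually_elim
    case (elim \<omega>)
    have const: "I (Y n \<omega>) = I (Y 0 \<omega>)" for n
    proof (induction n)
      case (Suc n)
      have "I (Y (Suc n) \<omega>) = I (Y n \<omega>)" using elim(2) lessI by blast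
      with Suc show ?case by simp
    qed simp
    have "I (X u \<omega>) = I (Y 0 \<omega>)" if "u \<ge> 0" for u
    proof -
      obtain n where "(\<Sum>k<n. R k \<omega>) \<le> ennreal u" "ennreal u < (\<Sum>k<Suc n. R k \<omega>)"
        using ennreal_partial_sums_straddle[of "\<lambda>k. R k \<omega>" u] elim(1) by blast
      with elim(1) that have "X u \<omega> = Y n \<omega>" by blast
      then show ?thesis using const[of n] by simp
    qed
    then show ?case using st by simp
  qed
qed

text \<open>A periodic profile is determined by its values on one period.\<close>

lemma countable_profiles:
  assumes "N \<ge> 1"
  shows "countable (profiles N)"
proof (rule countableI')
  let ?f = "\<lambda>h :: int \<Rightarrow> int. map (\<lambda>i. h (int i)) [0..<N]"
  show "inj_on ?f (profiles N)"
  proof (rule inj_onI, rule ext)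
    fix g h :: "int \<Rightarrow> int" and i :: int
    assume gh: "g \<in> profiles N" "h \<in> profiles N" "?f g = ?f h"
    have mod: "f (i mod int N) = f i" if "f \<in> profiles N" for f :: "int \<Rightarrow> int"
    proof -
      have up: "f (j + int N * int n) = f j" for j n
      proof (induction n)
        case (Suc n)
        then show ?case using that by (simp add: profiles_def algebra_simps) (metis add.assoc add.commute)
      qed simp
      show ?thesis
      proof (cases "i div int N \<ge> 0")
        case True
        then show ?thesis using up[of "i mod int N" "nat (i div int N)"] by simp
      next
        case False
        then have "i mod int N = i + int N * int (nat (- (i div int N)))"
          by (simp add: minus_div_mult_eq_mod[symmetric] algebra_simps)
        then show ?thesis using up[of i "nat (- (i div int N))"] by simp
      qed
    qed
    have "i mod int N = int (nat (i mod int N))" "nat (i mod int N) < N"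
      using assms by (auto simp: nat_less_iff)
    then have "g (i mod int N) = h (i mod int N)"
      using gh(3) by (auto simp: list_eq_iff_nth_eq) 
    then show "g i = h i" using mod[OF gh(1)] mod[OF gh(2)] by simp
  qed
qed

text \<open>Each residue class has exactly one representative in \<open>{1..int N}\<close>, so one unit is removed and
  one is added. This includes \<open>N = 1\<close>, where both sites coincide.\<close>

lemma sum_jump:
  assumes "N \<ge> 1"
  shows "(\<Sum>k\<in>{1..int N}. jump N i j h k) = (\<Sum>k\<in>{1..int N}. h k)"
proof -
  have one: "(\<Sum>k\<in>{1..int N}. of_bool (k mod int N = c mod int N) :: int) = 1" for c
  proof -
    have bij: "bij_betw (\<lambda>k. k mod int N) {1..int N} {0..<int N}"
    proof (rule bij_betw_byWitness[where f' = "\<lambda>k. if k = 0 then int N else k"])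
      show "\<forall>k\<in>{1..int N}. (if k mod int N = 0 then int N else k mod int N) = k"
      proof
        fix k assume "k \<in> {1..int N}"
        then show "(if k mod int N = 0 then int N else k mod int N) = k"
          by (cases "k = int N") auto
      qed
    qed (use assms in auto)
    have "(\<Sum>k\<in>{1..int N}. of_bool (k mod int N = c mod int N) :: int) = (\<Sum>k\<in>{0..<int N}. of_bool (k = c mod int N))"
      by (rule sum.reindex_bij_betw[OF bij, of "\<lambda>k. of_bool (k = c mod int N)"])
    also have "\<dots> = 1" using assms by (simp add: of_bool_def sum.delta)
    finally show ?thesis .
  qed
  show ?thesis by (simp add: jump_def sum.distrib sum_subtractf one)
qed

lemma jump_profile: "h \<in> profiles N \<Longrightarrow> jump N i j h \<in> profiles N"
  by (simp add: profiles_def jump_def)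

lemma height_rate_nonzero:
  assumes "height_rate K N h h' \<noteq> 0"
  obtains i where "i \<in> {1..int N}" "h' = jump N i (i + 1) h \<or> h' = jump N (i + 1) i h"
proof (rule ccontr)
  assume "\<not> thesis"
  with that have "h' \<noteq> jump N i (i + 1) h \<and> h' \<noteq> jump N (i + 1) i h" if "i \<in> {1..int N}" for i
    using \<open>i \<in> {1..int N}\<close> by blast
  then have "height_rate K N h h' = 0" unfolding height_rate_def by (intro sum.neutral) simp
  with assms show False by simp
qed

lemma height_sum_conserved:
  assumes h: "metropolis_height_process K N P h" and "N \<ge> 1" "0 \<le> s" "0 \<le> t"
  shows "AE \<omega> in P. (\<Sum>i\<in>{1..int N}. h s \<omega> i) = (\<Sum>i\<in>{1..int N}. h t \<omega> i)"
proof (rule markov_jump_process_invariant[where I = "\<lambda>x. \<Sum>i\<in>{1..int N}. x i" and X = h,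
      OF _ countable_profiles[OF \<open>N \<ge> 1\<close>] _ _ assms(3,4)])
  show "markov_jump_process (profiles N) (height_rate K N) P h"
    using h by (simp add: metropolis_height_process_def)
  show "finite {y. height_rate K N x y \<noteq> 0}" for x
  proof (rule finite_subset)
    show "{y. height_rate K N x y \<noteq> 0} \<subseteq>
        (\<lambda>i. jump N i (i + 1) x) ` {1..int N} \<union> (\<lambda>i. jump N (i + 1) i x) ` {1..int N}"
      by (auto elim!: height_rate_nonzero)
  qed simp
  show "y \<in> profiles N \<and> (\<Sum>i\<in>{1..int N}. y i) = (\<Sum>i\<in>{1..int N}. x i)"
    if "x \<in> profiles N" "height_rate K N x y \<noteq> 0" for x y
    using that(2)
  proof (rule height_rate_nonzero)
    fix i assume "y = jump N i (i + 1) x \<or> y = jump N (i + 1) i x"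
    then show ?thesis using that(1) jump_profile sum_jump[OF \<open>N \<ge> 1\<close>] by metis
  qed
qed


section \<open>Convergence of the height profiles\<close>

text \<open>The error term is small because its prefactor \<open>\<delta>\<close> can be taken arbitrarily small once \<open>N\<close> is large, while
  \<open>W\<close> is bounded in mean, hence in probability by Markov's inequality, and \<open>A\<close> is bounded in probability
  because it converges. The almost sure quantifier absorbs the null sets on which the total height is
  not conserved.\<close>

lemma tendsto_in_prob_dominated:
  fixes P :: "nat \<Rightarrow> 'a measure" and X A B W :: "nat \<Rightarrow> 'a \<Rightarrow> real"
  assumes ps: "\<And>N. N \<ge> 1 \<Longrightarrow> prob_space (P N)"
    and meas: "\<And>N. N \<ge> 1 \<Longrightarrow> A N \<in> borel_measurable (P N)" "\<And>N. N \<ge> 1 \<Longrightarrow> B N \<in> borel_measurable (P N)"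
      "\<And>N. N \<ge> 1 \<Longrightarrow> W N \<in> borel_measurable (P N)"
    and A: "tendsto_in_prob P A a" and B: "tendsto_in_prob P B b"
    and W: "\<And>N. N \<ge> 1 \<Longrightarrow> (\<integral>\<^sup>+ \<omega>. ennreal \<bar>W N \<omega>\<bar> \<partial>P N) \<le> ennreal C"
    and "0 \<le> C" "0 \<le> \<kappa>"
    and dom: "\<And>\<delta>. \<delta> > 0 \<Longrightarrow> \<forall>\<^sub>F N in sequentially. AE \<omega> in P N.
        \<bar>X N \<omega> - c\<bar> \<le> \<kappa> * \<bar>A N \<omega> - a\<bar> + \<bar>B N \<omega> - b\<bar> + \<delta> * (\<bar>W N \<omega>\<bar> + \<bar>A N \<omega>\<bar>)"
  shows "tendsto_in_prob P X c"
  unfolding tendsto_in_prob_def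
proof (intro allI impI)
  fix \<epsilon> :: real assume "\<epsilon> > 0"
  show "(\<lambda>N. measure (P N) {\<omega> \<in> space (P N). \<bar>X N \<omega> - c\<bar> > \<epsilon>}) \<longlonglongrightarrow> 0"
  proof (rule order_tendstoI)
    fix r :: real assume "0 < r"
    \<comment> \<open>By Markov's inequality \<open>\<bar>W N\<bar> \<ge> M\<close> has probability below \<open>r / 3\<close>; \<open>\<delta>\<close> keeps the error within \<open>\<epsilon> / 3\<close> if \<open>\<bar>W N\<bar> \<le> M\<close> and \<open>\<bar>A N\<bar> \<le> \<bar>a\<bar> + 1\<close>.\<close>
    define M where "M = 3 * C / r + 1"
    have M: "M > 0" "C / M < r / 3"
      using \<open>0 < r\<close> \<open>0 \<le> C\<close> by (auto simp: M_def field_simps add_pos_nonneg)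
    define \<eta> where "\<eta> = min 1 (\<epsilon> / (3 * (\<kappa> + 1)))"
    have \<eta>: "\<eta> > 0" "\<eta> \<le> 1" "\<kappa> * \<eta> \<le> \<epsilon> / 3"
    proof -
      show "\<eta> > 0" "\<eta> \<le> 1" using \<open>\<epsilon> > 0\<close> \<open>0 \<le> \<kappa>\<close> by (auto simp: \<eta>_def)
      have "\<kappa> * \<eta> \<le> \<kappa> * (\<epsilon> / (3 * (\<kappa> + 1)))" using \<open>0 \<le> \<kappa>\<close> by (intro mult_left_mono) (auto simp: \<eta>_def)
      also have "\<dots> \<le> \<epsilon> / 3" using \<open>0 \<le> \<kappa>\<close> \<open>\<epsilon> > 0\<close> by (auto simp: field_simps)
      finally show "\<kappa> * \<eta> \<le> \<epsilon> / 3" .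
    qed
    define \<delta> where "\<delta> = \<epsilon> / (3 * (M + \<bar>a\<bar> + 1))"
    have \<delta>: "\<delta> > 0" "\<delta> * (M + \<bar>a\<bar> + 1) = \<epsilon> / 3"
      using M(1) \<open>\<epsilon> > 0\<close> by (auto simp: \<delta>_def field_simps add_pos_nonneg add_nonneg_eq_0_iff)
    have eA: "\<forall>\<^sub>F N in sequentially. measure (P N) {\<omega> \<in> space (P N). \<bar>A N \<omega> - a\<bar> > \<eta>} < r / 3"
      using A \<eta>(1) \<open>0 < r\<close> unfolding tendsto_in_prob_def by (intro order_tendstoD(2)) auto
    have eB: "\<forall>\<^sub>F N in sequentially. measure (P N) {\<omega> \<in> space (P N). \<bar>B N \<omega> - b\<bar> > \<epsilon> / 3} < r / 3"
    proof (rule order_tendstoD(2))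
      show "(\<lambda>N. measure (P N) {\<omega> \<in> space (P N). \<bar>B N \<omega> - b\<bar> > \<epsilon> / 3}) \<longlonglongrightarrow> 0"
        using B \<open>\<epsilon> > 0\<close> unfolding tendsto_in_prob_def by (meson divide_pos_pos zero_less_numeral)
    qed (use \<open>0 < r\<close> in simp)
    show "\<forall>\<^sub>F N in sequentially. measure (P N) {\<omega> \<in> space (P N). \<bar>X N \<omega> - c\<bar> > \<epsilon>} < r"
      using dom[OF \<delta>(1)] eA eB eventually_ge_at_top[of 1]
    proof eventually_elim
      case (elim N)
      interpret prob_space "P N" using ps elim(4) .
      note [measurable] = meas[OF elim(4)]
      define EA where "EA = {\<omega> \<in> space (P N). \<bar>A N \<omega> - a\<bar> > \<eta>}"
      define EB where "EB = {\<omega> \<in> space (P N). \<bar>B N \<omega> - b\<bar> > \<epsilon> / 3}"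
      define EW where "EW = {\<omega> \<in> space (P N). 1 \<le> ennreal (1 / M) * ennreal \<bar>W N \<omega>\<bar>}"
      have [measurable]: "EA \<in> sets (P N)" "EB \<in> sets (P N)" "EW \<in> sets (P N)"
        unfolding EA_def EB_def EW_def by measurable
      have "prob {\<omega> \<in> space (P N). \<bar>X N \<omega> - c\<bar> > \<epsilon>} \<le> prob (EA \<union> EB \<union> EW)"
      proof (rule finite_measure_mono_AE)
        show "AE \<omega> in P N. \<omega> \<in> {\<omega> \<in> space (P N). \<bar>X N \<omega> - c\<bar> > \<epsilon>} \<longrightarrow> \<omega> \<in> EA \<union> EB \<union> EW"
          using elim(1)
        proof eventually_elim
          case (elim \<omega>)
          show ?case
          proof (intro impI, rule ccontr)
            assume "\<omega> \<in> {\<omega> \<in> space (P N). \<bar>X N \<omega> - c\<bar> > \<epsilon>}" and no: "\<omega> \<notin> EA \<union> EB \<union> EW"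
            then have \<omega>: "\<omega> \<in> space (P N)" "\<bar>X N \<omega> - c\<bar> > \<epsilon>" by auto
            have 1: "\<bar>A N \<omega> - a\<bar> \<le> \<eta>" "\<bar>B N \<omega> - b\<bar> \<le> \<epsilon> / 3"
              using no \<omega>(1) by (auto simp: EA_def EB_def)
            have "\<not> 1 \<le> ennreal (1 / M) * ennreal \<bar>W N \<omega>\<bar>" using no \<omega>(1) by (auto simp: EW_def)
            then have 2: "\<bar>W N \<omega>\<bar> \<le> M"
              using M(1) by (simp add: ennreal_mult[symmetric] ennreal_1[symmetric] field_simps del: ennreal_1)
            have 3: "\<bar>A N \<omega>\<bar> \<le> \<bar>a\<bar> + 1" using 1(1) \<eta>(2) by linarith
            have "\<kappa> * \<bar>A N \<omega> - a\<bar> \<le> \<kappa> * \<eta>" using 1(1) \<open>0 \<le> \<kappa>\<close> by (rule mult_left_mono)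
            moreover have "\<delta> * (\<bar>W N \<omega>\<bar> + \<bar>A N \<omega>\<bar>) \<le> \<delta> * (M + \<bar>a\<bar> + 1)"
              using 2 3 \<delta>(1) by (intro mult_left_mono) auto
            ultimately have "\<bar>X N \<omega> - c\<bar> \<le> \<epsilon>" using elim 1(2) \<eta>(3) \<delta>(2) by linarith
            with \<omega>(2) show False by simp
          qed
        qed
      qed simp
      also have "\<dots> \<le> prob EA + prob EB + prob EW"
        using measure_Un_le[of "EA \<union> EB" "P N" EW] measure_Un_le[of EA "P N" EB] by simp
      also have "prob EW \<le> C / M"
      proof -
        have "emeasure (P N) EW \<le> ennreal (1 / M) * (\<integral>\<^sup>+ \<omega>. ennreal \<bar>W N \<omega>\<bar> * indicator (space (P N)) \<omega> \<partial>P N)"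
          unfolding EW_def by (rule nn_integral_Markov_inequality) measurable
        also have "(\<integral>\<^sup>+ \<omega>. ennreal \<bar>W N \<omega>\<bar> * indicator (space (P N)) \<omega> \<partial>P N) = (\<integral>\<^sup>+ \<omega>. ennreal \<bar>W N \<omega>\<bar> \<partial>P N)"
          by (intro nn_integral_cong) simp
        also have "ennreal (1 / M) * \<dots> \<le> ennreal (1 / M) * ennreal C"
          by (intro mult_left_mono W elim) simp
        also have "\<dots> = ennreal (C / M)" using M(1) \<open>0 \<le> C\<close> by (simp add: ennreal_mult[symmetric])
        finally show ?thesis using M(1) \<open>0 \<le> C\<close> by (simp add: emeasure_eq_measure)
      qed
      finally show ?case using elim(2,3) M(2) unfolding EA_def EB_def by linarith
    qed
  next
    fix r :: real assume "r < 0"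
    then show "\<forall>\<^sub>F N in sequentially. r < measure (P N) {\<omega> \<in> space (P N). \<bar>X N \<omega> - c\<bar> > \<epsilon>}"
      by (intro always_eventually allI) (meson less_le_trans measure_nonneg)
  qed
qed

text \<open>The third differences of a periodic profile sum to zero, so testing with the constant function
  \<open>1\<close> identifies the limit. This is the solvability condition for the periodic third primitive.\<close>

lemma third_diff_limit_mean_zero:
  assumes ps: "\<And>N. N \<ge> 1 \<Longrightarrow> prob_space (P N)"
    and H: "\<And>N. N \<ge> 1 \<Longrightarrow> H N \<in> measurable (P N) (count_space (profiles N))"
    and conv: "profile_tendsto P 0 (\<lambda>N \<omega>. third_diff (H N \<omega>)) w"
  shows "integral {0..1} w = 0"
proof (rule ccontr)
  assume nz: "integral {0..1} w \<noteq> 0"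
  let ?X = "\<lambda>N \<omega>. 1 / real N * (\<Sum>i\<in>{1..int N}. 1 * real N powr (- 0) * of_int (third_diff (H N \<omega>) i))"
  have X: "tendsto_in_prob P ?X (integral {0..1} w)"
    using conv unfolding profile_tendsto_def by (auto simp: torus_fun_def dest!: spec[of _ "\<lambda>_. 1"])
  have lim: "(\<lambda>N. measure (P N) {\<omega> \<in> space (P N). \<bar>?X N \<omega> - integral {0..1} w\<bar> > \<bar>integral {0..1} w\<bar> / 2}) \<longlonglongrightarrow> 0"
    using X nz unfolding tendsto_in_prob_def by (elim allE[of _ "\<bar>integral {0..1} w\<bar> / 2"]) simp
  have "\<forall>\<^sub>F N in sequentially. measure (P N) {\<omega> \<in> space (P N). \<bar>?X N \<omega> - integral {0..1} w\<bar> > \<bar>integral {0..1} w\<bar> / 2} = 1"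
    using eventually_ge_at_top[of 1]
  proof eventually_elim
    case (elim N)
    have "\<bar>?X N \<omega> - integral {0..1} w\<bar> > \<bar>integral {0..1} w\<bar> / 2" if "\<omega> \<in> space (P N)" for \<omega>
    proof -
      have 0: "?X N \<omega> = 0"
        using sum_third_diff_eq_0[OF measurable_space[OF H[OF elim] that, simplified]] elim by simp
      show ?thesis unfolding 0 using nz by simp
    qed
    then have "{\<omega> \<in> space (P N). \<bar>?X N \<omega> - integral {0..1} w\<bar> > \<bar>integral {0..1} w\<bar> / 2} = space (P N)"
      by blast
    then show ?case using prob_space.prob_space[OF ps[OF elim]] by simp
  qed
  then have "(\<lambda>N. measure (P N) {\<omega> \<in> space (P N). \<bar>?X N \<omega> - integral {0..1} w\<bar> > \<bar>integral {0..1} w\<bar> / 2}) \<longlonglongrightarrow> 1"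
    by (rule tendsto_eventually)
  with lim show False using LIMSEQ_unique by fastforce
qed

text \<open>The convergence at a fixed time. \<open>H0\<close> and \<open>H\<close> are the heights at time \<open>0\<close> and at the time considered;
  conservation transfers the law of large numbers for the mean height from the former to the latter.\<close>

lemma profile_tendsto_heights:
  fixes P :: "nat \<Rightarrow> 'a measure" and H H0 :: "nat \<Rightarrow> 'a \<Rightarrow> int \<Rightarrow> int"
  assumes ps: "\<And>N. N \<ge> 1 \<Longrightarrow> prob_space (P N)"
    and H: "\<And>N. N \<ge> 1 \<Longrightarrow> H N \<in> measurable (P N) (count_space (profiles N))"
    and H0: "\<And>N. N \<ge> 1 \<Longrightarrow> H0 N \<in> measurable (P N) (count_space (profiles N))"
    and mean: "tendsto_in_prob P (\<lambda>N \<omega>. 1 / real N * (\<Sum>i\<in>{1..int N}. real N powr (- 3) * of_int (H0 N \<omega> i))) m"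
    and conserved: "\<And>N. N \<ge> 1 \<Longrightarrow> AE \<omega> in P N. (\<Sum>i\<in>{1..int N}. H0 N \<omega> i) = (\<Sum>i\<in>{1..int N}. H N \<omega> i)"
    and conv: "profile_tendsto P 0 (\<lambda>N \<omega>. third_diff (H N \<omega>)) w"
    and bound: "(SUP N\<in>{1..}. SUP i\<in>{1..int N}. \<integral>\<^sup>+ \<omega>. ennreal \<bar>of_int (third_diff (H N \<omega>) i)\<bar> \<partial>P N) < \<infinity>"
    and g: "periodic_third_primitive m w g"
  shows "profile_tendsto P 3 H g"
  unfolding profile_tendsto_def
proof (intro conjI allI impI)
  obtain gx where g': "torus_fun g" "\<And>x. (g has_real_derivative gx x) (at x)"
    using periodic_third_primitiveE[OF g] by blast
  show "torus_fun g" by fact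
  have "continuous_on {0..1} g" using g'(2) by (meson DERIV_isCont continuous_at_imp_continuous_on)
  then show "g absolutely_integrable_on {0..1}" by (rule absolutely_integrable_continuous_real)
  fix \<phi> :: "real \<Rightarrow> real" assume \<phi>: "torus_fun \<phi> \<and> continuous_on UNIV \<phi>"
  define c where "c = integral {0..1} \<phi>"
  obtain \<psi> \<psi>1 \<psi>2 where
    \<psi>: "\<And>x. (\<psi> has_real_derivative \<psi>1 x) (at x)" "\<And>x. (\<psi>1 has_real_derivative \<psi>2 x) (at x)"
      "\<And>x. (\<psi>2 has_real_derivative (c - \<phi> x)) (at x)" and
    \<psi>per: "torus_fun \<psi>" "torus_fun \<psi>1" "torus_fun \<psi>2"
    using ex_triple_primitive_of_test_function[of \<phi>] \<phi> unfolding c_def by blast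
  define C where "C = enn2real (SUP N\<in>{1..}. SUP i\<in>{1..int N}. \<integral>\<^sup>+ \<omega>. ennreal \<bar>of_int (third_diff (H N \<omega>) i)\<bar> \<partial>P N)"
  have C0: "0 \<le> C" by (simp add: C_def)
  have C: "(\<integral>\<^sup>+ \<omega>. ennreal \<bar>of_int (third_diff (H N \<omega>) i)\<bar> \<partial>P N) \<le> ennreal C"
    if "N \<ge> 1" "i \<in> {1..int N}" for N i
  proof -
    have "(\<integral>\<^sup>+ \<omega>. ennreal \<bar>of_int (third_diff (H N \<omega>) i)\<bar> \<partial>P N)
        \<le> (SUP N\<in>{1..}. SUP i\<in>{1..int N}. \<integral>\<^sup>+ \<omega>. ennreal \<bar>of_int (third_diff (H N \<omega>) i)\<bar> \<partial>P N)"
      using that by (intro SUP_upper2[of N] SUP_upper) auto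
    then show ?thesis unfolding C_def using bound by simp
  qed
  have meas: "(\<lambda>\<omega>. F (H N \<omega>)) \<in> borel_measurable (P N)"
    if "N \<ge> 1" for F :: "(int \<Rightarrow> int) \<Rightarrow> real" and N
    by (rule measurable_compose[OF H[OF that]]) simp
  have measE: "(\<lambda>\<omega>. F (H N \<omega>)) \<in> borel_measurable (P N)"
    if "N \<ge> 1" for F :: "(int \<Rightarrow> int) \<Rightarrow> ennreal" and N
    by (rule measurable_compose[OF H[OF that]]) simp
  have meas0: "(\<lambda>\<omega>. F (H0 N \<omega>)) \<in> borel_measurable (P N)"
    if "N \<ge> 1" for F :: "(int \<Rightarrow> int) \<Rightarrow> real" and N
    by (rule measurable_compose[OF H0[OF that]]) simp
  define A where "A = (\<lambda>N \<omega>. 1 / real N * (\<Sum>i\<in>{1..int N}. real N powr (- 3) * of_int (H0 N \<omega> i)))"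
  define B where "B = (\<lambda>N \<omega>. 1 / real N * (\<Sum>i\<in>{1..int N}. \<psi> (of_int i / real N) * real N powr (- 0) * of_int (third_diff (H N \<omega>) i)))"
  define W where "W = (\<lambda>N \<omega>. 1 / real N * (\<Sum>i\<in>{1..int N}. \<bar>of_int (third_diff (H N \<omega>) i)\<bar> :: real))"
  have eq: "integral {0..1} (\<lambda>x. \<phi> x * g x) = c * m + integral {0..1} (\<lambda>x. \<psi> x * w x)"
    using \<phi> by (intro integral_periodic_third_primitive[OF g _ \<psi> \<psi>per]) simp
  show "tendsto_in_prob P (\<lambda>N \<omega>. 1 / real N *
             (\<Sum>i\<in>{1..int N}. \<phi> (of_int i / real N) * real N powr (- 3) * of_int (H N \<omega> i)))
          (integral {0..1} (\<lambda>x. \<phi> x * g x))"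
    unfolding eq
  proof (rule tendsto_in_prob_dominated[where A = A and B = B and W = W and C = C and \<kappa> = "\<bar>c\<bar>"])
    show "tendsto_in_prob P A m" using mean by (simp add: A_def)
    have "continuous_on UNIV \<psi>" using \<psi>(1) by (meson DERIV_isCont continuous_at_imp_continuous_on)
    then show "tendsto_in_prob P B (integral {0..1} (\<lambda>x. \<psi> x * w x))"
      using conv \<psi>per(1) unfolding profile_tendsto_def B_def by blast
    show "0 \<le> C" by (rule C0)
  next
    fix N :: nat assume N: "N \<ge> 1"
    show "prob_space (P N)" by (rule ps[OF N])
    show "A N \<in> borel_measurable (P N)" unfolding A_def by (rule meas0[OF N])
    show "B N \<in> borel_measurable (P N)" unfolding B_def by (rule meas[OF N])
    show "W N \<in> borel_measurable (P N)" unfolding W_def by (rule meas[OF N])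
    have "(\<integral>\<^sup>+ \<omega>. ennreal \<bar>W N \<omega>\<bar> \<partial>P N)
        = (\<integral>\<^sup>+ \<omega>. ennreal (1 / real N) * (\<Sum>i\<in>{1..int N}. ennreal \<bar>of_int (third_diff (H N \<omega>) i)\<bar>) \<partial>P N)"
      by (intro nn_integral_cong) (simp add: W_def abs_mult sum_nonneg ennreal_mult[symmetric])
    also have "\<dots> = ennreal (1 / real N) * (\<Sum>i\<in>{1..int N}. \<integral>\<^sup>+ \<omega>. ennreal \<bar>of_int (third_diff (H N \<omega>) i)\<bar> \<partial>P N)"
      by (subst nn_integral_cmult, rule measE[OF N], subst nn_integral_sum, rule measE[OF N], rule refl)
    also have "\<dots> \<le> ennreal (1 / real N) * (\<Sum>i\<in>{1..int N}. ennreal C)"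
      by (intro mult_left_mono sum_mono C N) auto
    also have "\<dots> = ennreal (1 / real N) * ennreal (real N * C)"
      using C0 by (simp add: ennreal_mult ennreal_of_nat_eq_real_of_nat)
    also have "\<dots> = ennreal (1 / real N * (real N * C))"
      using C0 by (subst ennreal_mult) auto
    also have "\<dots> = ennreal C" using N by simp
    finally show "(\<integral>\<^sup>+ \<omega>. ennreal \<bar>W N \<omega>\<bar> \<partial>P N) \<le> ennreal C" .
  next
    fix \<delta> :: real assume "\<delta> > 0"
    then obtain d where d: "d > 0" "\<And>x y. \<bar>x - y\<bar> < d \<Longrightarrow> \<bar>\<phi> x - \<phi> y\<bar> < \<delta>"
      using periodic_uniformly_continuous[of \<phi> \<delta>] \<phi> by blast
    have "(\<lambda>N. 2 / real N) \<longlonglongrightarrow> 0" by real_asymp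
    then have "\<forall>\<^sub>F N in sequentially. 2 / real N < d" using d(1) by (rule order_tendstoD)
    then show "\<forall>\<^sub>F N in sequentially. AE \<omega> in P N.
        \<bar>1 / real N * (\<Sum>i\<in>{1..int N}. \<phi> (of_int i / real N) * real N powr (- 3) * of_int (H N \<omega> i))
          - (c * m + integral {0..1} (\<lambda>x. \<psi> x * w x))\<bar>
        \<le> \<bar>c\<bar> * \<bar>A N \<omega> - m\<bar> + \<bar>B N \<omega> - integral {0..1} (\<lambda>x. \<psi> x * w x)\<bar> + \<delta> * (\<bar>W N \<omega>\<bar> + \<bar>A N \<omega>\<bar>)"
      using eventually_ge_at_top[of 1]
    proof eventually_elim
      case (elim N)
      have close: "\<bar>\<phi> x - \<phi> y\<bar> \<le> \<delta>" if "\<bar>x - y\<bar> \<le> 2 / real N" for x y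
        using d(2)[of x y] that elim(1) by simp
      show ?case
        using conserved[OF elim(2)] AE_space
      proof eventually_elim
        case (elim \<omega>)
        have prof: "H N \<omega> \<in> profiles N" using measurable_space[OF H[OF \<open>1 \<le> N\<close>] elim(2)] by simp
        have "(\<Sum>i\<in>{1..int N}. real_of_int (H0 N \<omega> i)) = (\<Sum>i\<in>{1..int N}. real_of_int (H N \<omega> i))"
          using elim(1) by (metis of_int_sum)
        then have A: "1 / real N * (\<Sum>i\<in>{1..int N}. real N powr (- 3) * of_int (H N \<omega> i)) = A N \<omega>"
          by (simp add: A_def sum_distrib_left[symmetric])
        have B: "1 / real N * (\<Sum>i\<in>{1..int N}. \<psi> (of_int i / real N) * of_int (third_diff (H N \<omega>) i)) = B N \<omega>"
          using \<open>1 \<le> N\<close> by (simp add: B_def)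
        define S where "S = 1 / real N * (\<Sum>i\<in>{1..int N}. \<phi> (of_int i / real N) * real N powr (- 3) * of_int (H N \<omega> i))"
        have "\<bar>S - c * A N \<omega> - B N \<omega>\<bar> \<le> \<delta> * (W N \<omega> + \<bar>A N \<omega>\<bar>)"
          using test_function_estimate[OF prof \<open>1 \<le> N\<close> \<psi> \<psi>per(1) close, unfolded A B] by (simp add: S_def W_def)
        also have "\<dots> \<le> \<delta> * (\<bar>W N \<omega>\<bar> + \<bar>A N \<omega>\<bar>)" using \<open>\<delta> > 0\<close> by (intro mult_left_mono) auto
        finally have "\<bar>S - c * A N \<omega> - B N \<omega>\<bar> \<le> \<delta> * (\<bar>W N \<omega>\<bar> + \<bar>A N \<omega>\<bar>)" .
        moreover have "\<bar>c * A N \<omega> - c * m\<bar> = \<bar>c\<bar> * \<bar>A N \<omega> - m\<bar>" by (simp add: abs_mult[symmetric] right_diff_distrib)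
        ultimately show ?case unfolding S_def[symmetric] by linarith
      qed
    qed
  qed simp
qed

theorem claim4p1:
  fixes K T m :: real
    and P :: "nat \<Rightarrow> 'a measure"
    and h :: "nat \<Rightarrow> real \<Rightarrow> 'a \<Rightarrow> int \<Rightarrow> int"
    and w0 :: "real \<Rightarrow> real"
    and w :: "real \<Rightarrow> real \<Rightarrow> real"
  assumes "K > 0" and "T > 0"
    and "\<And>N. N \<ge> 1 \<Longrightarrow> metropolis_height_process K N (P N) (h N)"
    and "tendsto_in_prob P
           (\<lambda>N \<omega>. 1 / real N * (\<Sum>i\<in>{1..int N}. real N powr (- 3) * of_int (h N 0 \<omega> i))) m"
    and "profile_tendsto P 0 (\<lambda>N \<omega>. third_diff (h N 0 \<omega>)) w0"
    and "converges_hydrodynamically P 0 T (\<lambda>N t \<omega>. third_diff (h N t \<omega>)) w"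
    and "\<And>t. t \<ge> 0 \<Longrightarrow>
           (SUP N\<in>{1..}. SUP i\<in>{1..int N}.
              \<integral>\<^sup>+ \<omega>. ennreal \<bar>of_int (third_diff (h N t \<omega>) i)\<bar> \<partial>P N) < \<infinity>"
  shows "\<exists>hlim :: real \<Rightarrow> real \<Rightarrow> real.
           converges_hydrodynamically P 3 T h hlim \<and>
           (\<forall>t\<in>{0<..T}. periodic_third_primitive m (w t) (hlim t) \<and>
              (\<forall>g. periodic_third_primitive m (w t) g \<longrightarrow> g = hlim t))"
proof -
  have ps: "prob_space (P N)" and meas: "\<And>t. t \<ge> 0 \<Longrightarrow> h N t \<in> measurable (P N) (count_space (profiles N))"
    if "N \<ge> 1" for N
    using assms(3)[OF that] by (auto simp: metropolis_height_process_def markov_jump_process_def)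
  have key: "\<exists>g. periodic_third_primitive m u g \<and> profile_tendsto P 3 (\<lambda>N. h N t) g"
    if t: "t \<ge> 0" and u: "profile_tendsto P 0 (\<lambda>N \<omega>. third_diff (h N t \<omega>)) u" for t u
  proof -
    have "integral {0..1} u = 0"
      by (rule third_diff_limit_mean_zero[OF ps meas[OF _ t] u])
    moreover have "torus_fun u" "u absolutely_integrable_on {0..1}"
      using u by (auto simp: profile_tendsto_def)
    ultimately obtain g where g: "periodic_third_primitive m u g"
      using ex_periodic_third_primitive by blast
    have "profile_tendsto P 3 (\<lambda>N. h N t) g"
      by (rule profile_tendsto_heights[OF ps meas[OF _ t] meas[OF _ order_refl] assms(4)
            height_sum_conserved[OF assms(3) _ order_refl t] u assms(7)[OF t] g])
    with g show ?thesis by blast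
  qed
  obtain g0 where g0: "profile_tendsto P 3 (\<lambda>N. h N 0) g0"
    using key[OF order_refl assms(5)] by blast
  have "\<forall>t\<in>{0<..T}. \<exists>g. periodic_third_primitive m (w t) g \<and> profile_tendsto P 3 (\<lambda>N. h N t) g"
    using assms(6) key unfolding converges_hydrodynamically_def by simp
  then obtain hlim where hlim: "\<forall>t\<in>{0<..T}. periodic_third_primitive m (w t) (hlim t) \<and>
      profile_tendsto P 3 (\<lambda>N. h N t) (hlim t)"
    by metis
  show ?thesis
  proof (intro exI[of _ hlim] conjI ballI allI impI)
    show "converges_hydrodynamically P 3 T h hlim"
      unfolding converges_hydrodynamically_def using g0 hlim by blast
  qed (use hlim periodic_third_primitive_unique in blast)+
qed

end
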